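(* Let $p>2$, $q>p-1$ and $h\in L^1_{loc}(\mathbb{R}^N)$. Let $\mathcal{K}$ be the class of all $u\in W^{1,p}_{loc}(\mathbb{R}^N)\cap L^q_{loc}(\mathbb{R}^N)$ for which there exist $\theta<\frac1{p-2}$ and $c>0$ (both possibly depending on $u$) such that $|\nabla u(x)|\le c|x|^\theta$ for (a.e.) $x$ with $|x|$ large. Then the problem $$-\Delta_p u+|u|^{q-1}u=h\quad\text{on }\mathbb{R}^N$$ has at most one weak solution $v$ in the class $\mathcal{K}$. Moreover, such a solution $v$ satisfies $$\inf_{\mathbb{R}^N}h\le |v|^{q-1}v\le\sup_{\mathbb{R}^N}h\quad\text{a.e. on }\mathbb{R}^N .$$
   Context: $\Delta_p u=\mathrm{div}(|\nabla u|^{p-2}\nabla u)$ is the $p$-Laplacian. $C^1_0(\mathbb{R}^N)$ denotes compactly supported $C^1$ functions. A function $u\in W^{1,p}_{loc}(\mathbb{R}^N)\cap L^q_{loc}(\mathbb{R}^N)$ is a weak solution if $\int_{\mathbb{R}^N}|\nabla u|^{p-2}\nabla u\cdot\nabla\phi+\int_{\mathbb{R}^N}|u|^{q-1}u\,\phi=\int_{\mathbb{R}^N}h\phi$ for every $\phi\in C^1_0(\mathbb{R}^N)$. $\inf$ and $\sup$ of $h$ are essential infimum and supremum, possibly $-\infty$, $+\infty$. *)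

theory Defs
  imports "HOL-Analysis.Analysis" "HOL-Probability.Essential_Supremum"
begin

definition L_loc :: "real \<Rightarrow> ('a::euclidean_space \<Rightarrow> 'b::euclidean_space) set" where
  "L_loc r = {f \<in> borel_measurable lebesgue.
     \<forall>K. compact K \<longrightarrow> set_integrable lebesgue K (\<lambda>x. norm (f x) powr r)}"

definition grad :: "('a::euclidean_space \<Rightarrow> real) \<Rightarrow> 'a \<Rightarrow> 'a" where
  "grad \<phi> x = (THE D. GDERIV \<phi> x :> D)"

definition C1_0 :: "('a::euclidean_space \<Rightarrow> real) set" where
  "C1_0 = {\<phi>. (\<forall>x. \<phi> differentiable (at x)) \<and> continuous_on UNIV (grad \<phi>) \<and>
               compact (closure {x. \<phi> x \<noteq> 0})}"

text \<open>
  Weak gradients, with \<open>C\<^sup>1\<close> test functions as in Gilbarg and Trudinger, Section 7.3.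
\<close>

definition has_weak_gradient ::
    "('a::euclidean_space \<Rightarrow> real) \<Rightarrow> ('a \<Rightarrow> 'a) \<Rightarrow> bool" where
  "has_weak_gradient u g \<longleftrightarrow> u \<in> L_loc 1 \<and> g \<in> L_loc 1 \<and>
     (\<forall>\<phi>\<in>C1_0. \<forall>i\<in>Basis.
        (LINT x|lebesgue. u x * (grad \<phi> x \<bullet> i)) = - (LINT x|lebesgue. (g x \<bullet> i) * \<phi> x))"

text \<open>
  A weak gradient is unique only up to a null set; \<open>weak_grad u\<close> is an arbitrary representative.
  It is meaningful only if \<open>u\<close> has a weak gradient, which \<open>W1_loc\<close> requires explicitly.
\<close>

definition weak_grad :: "('a::euclidean_space \<Rightarrow> real) \<Rightarrow> 'a \<Rightarrow> 'a" where
  "weak_grad u = (SOME g. has_weak_gradient u g)"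

definition W1_loc :: "real \<Rightarrow> ('a::euclidean_space \<Rightarrow> real) set" where
  "W1_loc p = {u \<in> L_loc p. (\<exists>g. has_weak_gradient u g) \<and> weak_grad u \<in> L_loc p}"

text \<open>Weak solutions of \<open>- \<Delta>\<^sub>p u + |u|\<^bsup>q-1\<^esup> u = h\<close> on the whole space.\<close>

definition weak_solution ::
    "real \<Rightarrow> real \<Rightarrow> ('a::euclidean_space \<Rightarrow> real) \<Rightarrow> ('a \<Rightarrow> real) \<Rightarrow> bool" where
  "weak_solution p q h u \<longleftrightarrow> u \<in> W1_loc p \<inter> L_loc q \<and>
     (\<forall>\<phi>\<in>C1_0.
        (LINT x|lebesgue. (norm (weak_grad u x) powr (p - 2) *\<^sub>R weak_grad u x) \<bullet> grad \<phi> x)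
        + (LINT x|lebesgue. \<bar>u x\<bar> powr (q - 1) * u x * \<phi> x)
        = (LINT x|lebesgue. h x * \<phi> x))"

definition class_K :: "real \<Rightarrow> real \<Rightarrow> ('a::euclidean_space \<Rightarrow> real) set" where
  "class_K p q = {u \<in> W1_loc p \<inter> L_loc q.
     \<exists>\<theta> c R. \<theta> < 1 / (p - 2) \<and> c > 0 \<and>
       (AE x in lebesgue. norm x \<ge> R \<longrightarrow> norm (weak_grad u x) \<le> c * norm x powr \<theta>)}"

definition essinf :: "'a measure \<Rightarrow> ('a \<Rightarrow> ereal) \<Rightarrow> ereal" where
  "essinf M f = Sup {z. AE x in M. z \<le> f x}"

end

theory Submission
  imports Defs
begin

text \<open>
  Both claims are instances of a comparison principle for sub- and supersolutions \<open>u\<close>, \<open>v\<close>: for the bounds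
  one of the two is the constant \<open>k\<close> with \<open>|k|\<^bsup>q-1\<^esup> k\<close> equal to the supremum or infimum of \<open>h\<close>.
  Put \<open>w = u - v\<close>, \<open>F = |\<nabla>u|\<^bsup>p-2\<^esup> \<nabla>u - |\<nabla>v|\<^bsup>p-2\<^esup> \<nabla>v\<close> and
  \<open>G = |u|\<^bsup>q-1\<^esup> u - |v|\<^bsup>q-1\<^esup> v\<close>, so that \<open>div F \<ge> G\<close> weakly, and test with \<open>\<psi>(w) \<eta>\<close>, where
  \<open>\<psi>(t) = exp (- t\<^bsup>1-q\<^esup>)\<close> for \<open>t > 0\<close> and \<open>\<psi>(t) = 0\<close> otherwise, and \<open>\<eta>\<close> is a cutoff between the balls of
  radius \<open>R\<close> and \<open>2R\<close>. As \<open>(q - 1) \<psi> = t\<^sup>q \<psi>' \<le> C G \<psi>'\<close> at \<open>t = w > 0\<close> and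
  \<open>|F|\<^sup>2 \<le> C (|\<nabla>u| + |\<nabla>v|)\<^bsup>p-2\<^esup> F \<bullet> \<nabla>w\<close>, Cauchy's inequality absorbs the gradient terms, and
  \<open>I(R)\<close>, the integral of \<open>G \<psi>(w)\<close> over the ball of radius \<open>R\<close>, satisfies
  \<open>I(R) \<le> C R\<^bsup>\<theta>(p-2)-2\<^esup> I(2R)\<close>. The exponent is negative and \<open>I\<close> is increasing and grows at most polynomially,
  so iterating gives \<open>I = 0\<close>, that is \<open>w \<le> 0\<close>. The test function is justified by mollifying \<open>w\<close>.
\<close>

subsection \<open>Gradients and test functions\<close>

lemma GDERIV_unique:
  assumes "GDERIV f x :> D" "GDERIV f x :> E"
  shows "D = E"
proof -
  have "(\<lambda>h. h \<bullet> D) = (\<lambda>h. h \<bullet> E)"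
    using assms unfolding gderiv_def by (rule has_derivative_unique)
  then have "(D - E) \<bullet> (D - E) = 0"
    by (metis inner_diff_right right_minus_eq)
  then show ?thesis
    by simp
qed

lemma grad_eqI: "GDERIV f x :> D \<Longrightarrow> grad f x = D"
  unfolding grad_def by (blast intro: GDERIV_unique)

lemma GDERIV_grad:
  fixes f :: "'a::euclidean_space \<Rightarrow> real"
  assumes "f differentiable (at x)"
  shows "GDERIV f x :> grad f x"
proof -
  obtain f' where f': "(f has_derivative f') (at x)"
    using assms by (auto simp: differentiable_def)
  have "f' = (\<lambda>h. h \<bullet> (\<Sum>b\<in>Basis. f' b *\<^sub>R b))"
  proof
    fix h
    interpret linear f' by (rule has_derivative_linear[OF f'])
    have "f' h = f' (\<Sum>b\<in>Basis. (h \<bullet> b) *\<^sub>R b)"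
      by (simp add: euclidean_representation)
    also have "\<dots> = h \<bullet> (\<Sum>b\<in>Basis. f' b *\<^sub>R b)"
      by (simp add: sum scaleR inner_sum_right mult.commute)
    finally show "f' h = h \<bullet> (\<Sum>b\<in>Basis. f' b *\<^sub>R b)" .
  qed
  then have "GDERIV f x :> (\<Sum>b\<in>Basis. f' b *\<^sub>R b)"
    using f' by (simp add: gderiv_def)
  then show ?thesis
    using grad_eqI by metis
qed

lemma GDERIV_imp_isCont: "GDERIV f x :> D \<Longrightarrow> isCont f x"
  unfolding gderiv_def by (rule has_derivative_continuous)

lemma GDERIV_imp_continuous_on: "(\<And>x. GDERIV f x :> D x) \<Longrightarrow> continuous_on S f"
  by (blast intro: continuous_at_imp_continuous_on GDERIV_imp_isCont)

lemma GDERIV_affine: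
  assumes "GDERIV f (a + c *\<^sub>R x) :> D"
  shows "GDERIV (\<lambda>x. f (a + c *\<^sub>R x)) x :> c *\<^sub>R D"
proof -
  have "((\<lambda>x. a + c *\<^sub>R x) has_derivative (\<lambda>h. c *\<^sub>R h)) (at x)"
    by (auto intro!: derivative_eq_intros)
  from has_derivative_compose[OF this assms[unfolded gderiv_def]] show ?thesis
    by (simp add: gderiv_def)
qed

lemma GDERIV_norm_square:
  fixes x :: "'a::real_inner"
  shows "GDERIV (\<lambda>x. (norm x)\<^sup>2) x :> 2 *\<^sub>R x"
  unfolding gderiv_def power2_norm_eq_inner
  by (auto intro!: derivative_eq_intros simp: inner_commute)

definition C_c :: "('a::real_normed_vector \<Rightarrow> 'b::real_normed_vector) set" where
  "C_c = {f. continuous_on UNIV f \<and> (\<exists>R. \<forall>x. R < norm x \<longrightarrow> f x = 0)}"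

lemma C_c_continuous: "f \<in> C_c \<Longrightarrow> continuous_on S f"
  by (auto simp: C_c_def intro: continuous_on_subset)

lemma C_c_measurable [measurable_dest]:
  fixes f :: "'a::euclidean_space \<Rightarrow> 'b::euclidean_space"
  assumes "f \<in> C_c"
  shows "f \<in> borel_measurable borel" "f \<in> borel_measurable lebesgue"
  using borel_measurable_continuous_onI[OF C_c_continuous[OF assms]]
  by (auto intro: measurable_completion)

lemma C_c_bound:
  fixes f :: "'a::euclidean_space \<Rightarrow> 'b::real_normed_vector"
  assumes "f \<in> C_c"
  obtains R B where "B > 0" "\<And>x. norm (f x) \<le> B * indicator (cball 0 R) x" "\<And>x. norm (f x) \<le> B"
proof -
  obtain R where vanishes: "\<And>x. R < norm x \<Longrightarrow> f x = 0"
    using assms by (auto simp: C_c_def)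
  have "compact (f ` cball 0 R)"
    by (intro compact_continuous_image C_c_continuous assms) simp
  then obtain B where B: "B > 0" "\<And>x. x \<in> cball 0 R \<Longrightarrow> norm (f x) \<le> B"
    using compact_imp_bounded bounded_pos by (metis image_eqI)
  then have "norm (f x) \<le> B * indicator (cball 0 R) x" "norm (f x) \<le> B" for x
    using vanishes[of x] by (cases "x \<in> cball 0 R"; simp)+
  with B(1) show thesis using that by blast
qed

lemma C_c_affine:
  assumes f: "f \<in> C_c" and "c \<noteq> 0"
  shows "(\<lambda>x. f (a + c *\<^sub>R x)) \<in> C_c"
proof -
  obtain R where vanishes: "\<And>x. R < norm x \<Longrightarrow> f x = 0"
    using f by (auto simp: C_c_def)
  have "f (a + c *\<^sub>R x) = 0" if "(R + norm a) / \<bar>c\<bar> < norm x" for x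
  proof (rule vanishes)
    have "R + norm a < norm (c *\<^sub>R x)"
      using that \<open>c \<noteq> 0\<close> by (simp add: divide_less_eq mult.commute)
    also have "\<dots> \<le> norm (a + c *\<^sub>R x) + norm a"
      using norm_triangle_ineq4[of "a + c *\<^sub>R x" a] by simp
    finally show "R < norm (a + c *\<^sub>R x)" by simp
  qed
  moreover have "continuous_on UNIV (\<lambda>x. f (a + c *\<^sub>R x))"
    by (intro continuous_on_compose2[OF C_c_continuous[OF f]] continuous_intros) auto
  ultimately show ?thesis
    by (auto simp: C_c_def)
qed

lemma grad_eq_0_of_locally_const:
  fixes f :: "'a::euclidean_space \<Rightarrow> real"
  assumes "open S" "x \<in> S" "\<And>y. y \<in> S \<Longrightarrow> f y = c"
  shows "grad f x = 0"
proof (rule grad_eqI)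
  show "GDERIV f x :> 0"
    using has_derivative_transform_within_open[OF GDERIV_const[of c x, unfolded gderiv_def] assms(1,2)] assms(3)
    by (simp add: gderiv_def)
qed

lemma C1_0_D:
  fixes f :: "'a::euclidean_space \<Rightarrow> real"
  assumes f: "f \<in> C1_0"
  shows C1_0_GDERIV: "\<And>x. GDERIV f x :> grad f x" and C1_0_C_c: "f \<in> C_c" and C1_0_grad_C_c: "grad f \<in> C_c"
proof -
  show deriv: "GDERIV f x :> grad f x" for x
    using f by (simp add: C1_0_def GDERIV_grad)
  have "bounded {x. f x \<noteq> 0}"
    using f by (simp add: C1_0_def compact_closure)
  then obtain R where R: "\<And>x. R < norm x \<Longrightarrow> f x = 0"
    unfolding bounded_iff by (metis linorder_not_le mem_Collect_eq)
  have "grad f x = 0" if "R < norm x" for x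
    using that R by (intro grad_eq_0_of_locally_const[of "- cball 0 R" _ _ 0]) auto
  with R deriv show "f \<in> C_c" "grad f \<in> C_c"
    using f by (auto simp: C_c_def C1_0_def intro: GDERIV_imp_continuous_on)
qed

lemma C1_0_I:
  fixes f :: "'a::euclidean_space \<Rightarrow> real"
  assumes deriv: "\<And>x. GDERIV f x :> D x" and D: "continuous_on UNIV D"
    and vanishes: "\<And>x. R < norm x \<Longrightarrow> f x = 0"
  shows "f \<in> C1_0"
proof -
  have "grad f = D"
    using deriv grad_eqI by blast
  moreover have "bounded {x. f x \<noteq> 0}"
    using vanishes unfolding bounded_iff by (metis linorder_not_le mem_Collect_eq)
  moreover have "f differentiable (at x)" for x
    using deriv by (auto simp: gderiv_def differentiable_def)
  ultimately show ?thesis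
    using D by (simp add: C1_0_def)
qed

lemma C1_0_mult:
  fixes f \<phi> :: "'a::euclidean_space \<Rightarrow> real"
  assumes f: "\<And>x. GDERIV f x :> D x" "continuous_on UNIV D" and \<phi>: "\<phi> \<in> C1_0"
  shows "(\<lambda>x. f x * \<phi> x) \<in> C1_0" and "grad (\<lambda>x. f x * \<phi> x) x = f x *\<^sub>R grad \<phi> x + \<phi> x *\<^sub>R D x"
proof -
  have deriv: "GDERIV (\<lambda>x. f x * \<phi> x) x :> f x *\<^sub>R grad \<phi> x + \<phi> x *\<^sub>R D x" for x
    by (rule GDERIV_mult[OF f(1) C1_0_GDERIV[OF \<phi>]])
  then show "grad (\<lambda>x. f x * \<phi> x) x = f x *\<^sub>R grad \<phi> x + \<phi> x *\<^sub>R D x"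
    by (rule grad_eqI)
  obtain R where "\<And>x. R < norm x \<Longrightarrow> \<phi> x = 0"
    using C1_0_C_c[OF \<phi>] by (auto simp: C_c_def)
  then show "(\<lambda>x. f x * \<phi> x) \<in> C1_0"
    using f(2) GDERIV_imp_continuous_on[OF f(1)] C1_0_D(2,3)[OF \<phi>, THEN C_c_continuous]
    by (intro C1_0_I[OF deriv, of R] continuous_intros) auto
qed

lemma C1_0_affine:
  fixes f :: "'a::euclidean_space \<Rightarrow> real"
  assumes f: "f \<in> C1_0" and c: "c \<noteq> 0"
  shows "(\<lambda>x. f (a + c *\<^sub>R x)) \<in> C1_0" and "grad (\<lambda>x. f (a + c *\<^sub>R x)) x = c *\<^sub>R grad f (a + c *\<^sub>R x)"
proof -
  have deriv: "GDERIV (\<lambda>x. f (a + c *\<^sub>R x)) x :> c *\<^sub>R grad f (a + c *\<^sub>R x)" for x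
    by (intro GDERIV_affine C1_0_GDERIV f)
  then show "grad (\<lambda>x. f (a + c *\<^sub>R x)) x = c *\<^sub>R grad f (a + c *\<^sub>R x)"
    by (rule grad_eqI)
  obtain R where "\<And>x. R < norm x \<Longrightarrow> f (a + c *\<^sub>R x) = 0"
    using C_c_affine[OF C1_0_C_c[OF f] c, of a] by (auto simp: C_c_def)
  then show "(\<lambda>x. f (a + c *\<^sub>R x)) \<in> C1_0"
    using C_c_affine[OF C1_0_grad_C_c[OF f] c]
    by (intro C1_0_I[OF deriv, of R] continuous_intros C_c_continuous) auto
qed

definition pos_sq :: "real \<Rightarrow> real" where
  "pos_sq t = (max 0 t)\<^sup>2"

lemma pos_sq_nonneg: "0 \<le> pos_sq t"
  by (simp add: pos_sq_def)

lemma pos_sq_increment_bound: "\<bar>pos_sq s - pos_sq t - 2 * max 0 t * (s - t)\<bar> \<le> (s - t)\<^sup>2"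
proof -
  consider (both_nonneg) "0 \<le> s" "0 \<le> t" | (s_neg) "s < 0" "0 \<le> t"
    | (t_neg) "0 \<le> s" "t < 0" | (both_neg) "s < 0" "t < 0"
    by linarith
  then show ?thesis
  proof cases
    case both_nonneg
    then have "pos_sq s - pos_sq t - 2 * max 0 t * (s - t) = (s - t)\<^sup>2"
      by (simp add: pos_sq_def power2_eq_square algebra_simps)
    then show ?thesis by simp
  next
    case s_neg
    then have "s * t \<le> 0" by (simp add: mult_nonpos_nonneg)
    then have "\<bar>t * t - s * (t * 2)\<bar> = t * t - s * (t * 2)"
      using zero_le_square[of t] by linarith
    then show ?thesis
      using s_neg by (simp add: pos_sq_def power2_eq_square algebra_simps)
  next
    case t_neg
    then have "s * t \<le> 0" by (simp add: mult_nonneg_nonpos)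
    then show ?thesis
      using t_neg zero_le_power2[of t] by (simp add: pos_sq_def power2_eq_square algebra_simps)
  qed (simp add: pos_sq_def)
qed

lemma DERIV_pos_sq: "(pos_sq has_real_derivative 2 * max 0 t) (at t)"
  unfolding has_field_derivative_def
proof (rule has_derivativeI_sandwich[of 1])
  show "norm (pos_sq s - pos_sq t - 2 * max 0 t * (s - t)) / norm (s - t) \<le> \<bar>s - t\<bar>" if "s \<noteq> t" for s
    using that pos_sq_increment_bound[of s t] by (simp add: divide_le_eq power2_eq_square abs_mult_self_eq)
  show "((\<lambda>s. \<bar>s - t\<bar>) \<longlongrightarrow> 0) (at t)"
    by (auto intro!: tendsto_eq_intros)
qed (auto intro: bounded_linear_mult_right)

lemma C1_0_bump_exists:
  obtains \<xi> :: "'a::euclidean_space \<Rightarrow> real"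
  where "\<xi> \<in> C1_0" "\<And>x. 0 \<le> \<xi> x" "\<And>x. \<xi> x \<le> 1"
    "\<And>x. norm x \<le> 1 \<Longrightarrow> \<xi> x = 1" "\<And>x. 2 \<le> norm x \<Longrightarrow> \<xi> x = 0"
proof
  define s D where "s x = (norm x)\<^sup>2 - 1"
    and "D x = (2 * max 0 (1 - pos_sq (s x))) *\<^sub>R (0 - (2 * max 0 (s x)) *\<^sub>R (2 *\<^sub>R x - 0))" for x :: 'a
  define \<xi> where "\<xi> x = pos_sq (1 - pos_sq (s x))" for x
  have deriv: "GDERIV \<xi> x :> D x" for x
    unfolding \<xi>_def[abs_def] D_def s_def
    by (intro GDERIV_DERIV_compose[OF _ DERIV_pos_sq] GDERIV_diff GDERIV_const GDERIV_norm_square)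
  have continuous: "continuous_on UNIV D"
    unfolding D_def s_def pos_sq_def by (intro continuous_intros)
  show "0 \<le> \<xi> x" for x by (simp add: \<xi>_def pos_sq_nonneg)
  show "\<xi> x \<le> 1" for x
    using pos_sq_nonneg[of "s x"] power_mono[of "max 0 (1 - pos_sq (s x))" 1 2]
    by (simp add: \<xi>_def pos_sq_def[of "1 - _"])
  show "\<xi> x = 1" if "norm x \<le> 1" for x
    using power_mono[OF that, of 2] by (simp add: \<xi>_def s_def pos_sq_def max_absorb1)
  show outside: "\<xi> x = 0" if "2 \<le> norm x" for x
  proof -
    have "1 \<le> s x" using power_mono[OF that, of 2] by (simp add: s_def)
    then have "1 \<le> pos_sq (s x)" using power_mono[of 1 "s x" 2] by (simp add: pos_sq_def)
    then show ?thesis by (simp add: \<xi>_def pos_sq_def[of "1 - _"])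
  qed
  show "\<xi> \<in> C1_0"
    by (rule C1_0_I[OF deriv continuous, of 2]) (simp add: outside)
qed

subsection \<open>Local Lebesgue spaces\<close>

lemma L_loc_measurable [measurable_dest]: "f \<in> L_loc r \<Longrightarrow> f \<in> borel_measurable lebesgue"
  by (simp add: L_loc_def)

lemma L_loc_1_iff:
  fixes f :: "'a::euclidean_space \<Rightarrow> 'b::euclidean_space"
  shows "f \<in> L_loc 1 \<longleftrightarrow> f \<in> borel_measurable lebesgue \<and> (\<forall>K. compact K \<longrightarrow> set_integrable lebesgue K f)"
proof -
  have "set_integrable lebesgue K (\<lambda>x. norm (f x)) \<longleftrightarrow> set_integrable lebesgue K f"
    if [measurable]: "f \<in> borel_measurable lebesgue" and "compact K" for K
  proof -
    have [measurable]: "K \<in> sets lebesgue"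
      using \<open>compact K\<close> by (simp add: compact_imp_closed sets_completionI_sets)
    have "(\<lambda>x. norm (indicat_real K x *\<^sub>R f x)) = (\<lambda>x. indicat_real K x *\<^sub>R norm (f x))"
      by auto
    then show ?thesis
      using integrable_norm_iff[of "\<lambda>x. indicat_real K x *\<^sub>R f x" lebesgue]
      by (simp add: set_integrable_def)
  qed
  then show ?thesis
    by (auto simp: L_loc_def)
qed

lemma L_loc_1_integrable_cball:
  "f \<in> L_loc 1 \<Longrightarrow> integrable lebesgue (\<lambda>x. indicat_real (cball a R) x *\<^sub>R f x)"
  unfolding L_loc_1_iff set_integrable_def by simp

lemma L_loc_norm_powr: "f \<in> L_loc r \<Longrightarrow> (\<lambda>x. norm (f x) powr r) \<in> L_loc 1"
  unfolding L_loc_1_iff by (auto simp: L_loc_def)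

lemma L_loc_dominated:
  fixes f :: "'a::euclidean_space \<Rightarrow> 'b::euclidean_space" and g :: "'a \<Rightarrow> real"
  assumes g: "g \<in> L_loc 1" and [measurable]: "f \<in> borel_measurable lebesgue"
    and bound: "\<And>x. norm (f x) powr r \<le> g x"
  shows "f \<in> L_loc r"
proof -
  have "set_integrable lebesgue K (\<lambda>x. norm (f x) powr r)" if "compact K" for K
  proof (rule set_integrable_bound)
    show "set_integrable lebesgue K g"
      using g that by (simp add: L_loc_1_iff)
    have "K \<in> sets lebesgue"
      using that by (simp add: compact_imp_closed sets_completionI_sets)
    then show "set_borel_measurable lebesgue K (\<lambda>x. norm (f x) powr r)"
      unfolding set_borel_measurable_def by measurable
  qed (use bound in \<open>auto intro: order_trans[OF _ abs_ge_self]\<close>)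
  then show ?thesis
    by (simp add: L_loc_def)
qed

lemma L_loc_1_add: "f \<in> L_loc 1 \<Longrightarrow> g \<in> L_loc 1 \<Longrightarrow> (\<lambda>x. f x + g x) \<in> L_loc 1"
  unfolding L_loc_1_iff by auto

lemma L_loc_1_scaleR: "f \<in> L_loc 1 \<Longrightarrow> (\<lambda>x. c *\<^sub>R f x) \<in> L_loc 1"
  unfolding L_loc_1_iff by auto

lemma L_loc_const: "(\<lambda>_. c) \<in> L_loc r"
  unfolding L_loc_def set_integrable_def
  by (auto simp: compact_imp_closed compact_imp_bounded sets_completionI_sets
      intro!: integrable_scaleR_left integrable_real_indicator
        emeasure_bounded_finite[unfolded infinity_ennreal_def])

lemma integrable_imp_L_loc_1: "integrable lebesgue f \<Longrightarrow> f \<in> L_loc 1"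
  unfolding L_loc_1_iff set_integrable_def
  by (auto simp: compact_imp_closed sets_completionI_sets intro: integrable_mult_indicator)

lemma L_loc_mono:
  fixes f :: "'a::euclidean_space \<Rightarrow> 'b::euclidean_space"
  assumes f: "f \<in> L_loc s" and "0 \<le> r" "r \<le> s"
  shows "f \<in> L_loc r"
proof (rule L_loc_dominated[OF L_loc_1_add[OF L_loc_const[of 1] L_loc_norm_powr[OF f]]])
  show "norm (f x) powr r \<le> 1 + norm (f x) powr s" for x
  proof (cases "norm (f x) \<le> 1")
    case True
    then show ?thesis
      using powr_mono2[of r "norm (f x)" 1] \<open>0 \<le> r\<close> by (simp add: add_increasing2)
  next
    case False
    then show ?thesis
      using \<open>r \<le> s\<close> by (intro add_increasing powr_mono) auto
  qed
qed (use f in measurable)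

lemma powr_add_le:
  fixes x y r :: real
  assumes "0 \<le> x" "0 \<le> y" "0 < r"
  shows "(x + y) powr r \<le> 2 powr r * (x powr r + y powr r)"
proof -
  have "(x + y) powr r \<le> (2 * max x y) powr r"
    using assms by (intro powr_mono2) auto
  also have "\<dots> = 2 powr r * max x y powr r"
    using assms by (simp add: powr_mult)
  also have "\<dots> \<le> 2 powr r * (x powr r + y powr r)"
    by (intro mult_left_mono) (auto simp: max_def)
  finally show ?thesis .
qed

lemma L_loc_diff:
  fixes f g :: "'a::euclidean_space \<Rightarrow> 'b::euclidean_space"
  assumes f: "f \<in> L_loc r" and g: "g \<in> L_loc r" and r: "0 < r"
  shows "(\<lambda>x. f x - g x) \<in> L_loc r"
proof (rule L_loc_dominated)
  show "(\<lambda>x. 2 powr r *\<^sub>R (norm (f x) powr r + norm (g x) powr r)) \<in> L_loc 1"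
    by (intro L_loc_1_scaleR L_loc_1_add L_loc_norm_powr f g)
  show "norm (f x - g x) powr r \<le> 2 powr r *\<^sub>R (norm (f x) powr r + norm (g x) powr r)" for x
  proof -
    have "norm (f x - g x) powr r \<le> (norm (f x) + norm (g x)) powr r"
      using r by (intro powr_mono2 norm_triangle_ineq4) auto
    also have "\<dots> \<le> 2 powr r *\<^sub>R (norm (f x) powr r + norm (g x) powr r)"
      using powr_add_le r by simp
    finally show ?thesis .
  qed
qed (use f g in measurable)

lemma integrable_bilinear_L_loc_1_C_c:
  fixes f :: "'a::euclidean_space \<Rightarrow> 'b::euclidean_space" and g :: "'a \<Rightarrow> 'c::euclidean_space"
    and B :: "'b \<Rightarrow> 'c \<Rightarrow> 'd::euclidean_space"
  assumes "bounded_bilinear B" and f: "f \<in> L_loc 1" and g: "g \<in> C_c"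
  shows "integrable lebesgue (\<lambda>x. B (f x) (g x))"
proof -
  interpret bounded_bilinear B by fact
  note [measurable] = L_loc_measurable[OF f] C_c_measurable[OF g]
  obtain C where C: "0 < C" "\<And>a b. norm (B a b) \<le> norm a * norm b * C"
    using pos_bounded by blast
  obtain R M where M: "0 < M" "\<And>x. norm (g x) \<le> M * indicator (cball 0 R) x"
    using C_c_bound[OF g] by metis
  show ?thesis
  proof (rule Bochner_Integration.integrable_bound)
    show "integrable lebesgue (\<lambda>x. (C * M) *\<^sub>R (indicator (cball 0 R) x *\<^sub>R f x))"
      by (intro integrable_scaleR_right L_loc_1_integrable_cball f)
    show "(\<lambda>x. B (f x) (g x)) \<in> borel_measurable lebesgue"
      by (rule borel_measurable_continuous_Pair[where H = B])
        (measurable, intro continuous_on continuous_on_fst continuous_on_snd continuous_on_id)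
    have "norm (B (f x) (g x)) \<le> norm ((C * M) *\<^sub>R (indicat_real (cball 0 R) x *\<^sub>R f x))" for x
    proof -
      have "norm (B (f x) (g x)) \<le> norm (f x) * norm (g x) * C"
        by (rule C(2))
      also have "\<dots> \<le> norm (f x) * (M * indicator (cball 0 R) x) * C"
        using C(1) M(2) by (intro mult_right_mono mult_left_mono) auto
      also have "\<dots> = norm ((C * M) *\<^sub>R (indicat_real (cball 0 R) x *\<^sub>R f x))"
        using C(1) M(1) by (simp add: abs_mult)
      finally show ?thesis .
    qed
    then show "AE x in lebesgue. norm (B (f x) (g x)) \<le> norm ((C * M) *\<^sub>R (indicat_real (cball 0 R) x *\<^sub>R f x))"
      by simp
  qed
qed

lemmas integrable_mult_L_loc_1_C_c = integrable_bilinear_L_loc_1_C_c[OF bounded_bilinear_mult]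
  and integrable_scaleR_L_loc_1_C_c = integrable_bilinear_L_loc_1_C_c[OF bounded_bilinear_scaleR]
  and integrable_inner_L_loc_1_C_c = integrable_bilinear_L_loc_1_C_c[OF bounded_bilinear_inner]

lemma integrable_scaleR_C_c_L_loc_1:
  fixes k :: "'a::euclidean_space \<Rightarrow> real" and f :: "'a \<Rightarrow> 'b::euclidean_space"
  assumes "k \<in> C_c" "f \<in> L_loc 1"
  shows "integrable lebesgue (\<lambda>x. k x *\<^sub>R f x)"
  by (rule integrable_bilinear_L_loc_1_C_c[OF bounded_bilinear.flip[OF bounded_bilinear_scaleR] assms(2,1)])

lemma integral_lebesgue_affine:
  fixes f :: "'a::euclidean_space \<Rightarrow> 'b::euclidean_space"
  assumes f: "f \<in> borel_measurable lebesgue" and c: "c \<noteq> 0"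
  shows "\<bar>c\<bar> ^ DIM('a) *\<^sub>R (LINT x|lebesgue. f (a + c *\<^sub>R x)) = (LINT x|lebesgue. f x)"
proof -
  define T :: "'a \<Rightarrow> 'a" where "T x = a + c *\<^sub>R x" for x
  have T: "T = (\<lambda>x. a + (\<Sum>j\<in>Basis. (c * (x \<bullet> j)) *\<^sub>R j))"
    by (simp add: T_def fun_eq_iff euclidean_representation flip: scaleR_scaleR scaleR_sum_right)
  have [measurable]: "T \<in> lebesgue \<rightarrow>\<^sub>M lebesgue"
    unfolding T using c by (intro lebesgue_affine_measurable) auto
  let ?D = "density (distr lebesgue lebesgue T) (\<lambda>_. ennreal (\<bar>c\<bar> ^ DIM('a)))"
  have "lebesgue = ?D"
    using lebesgue_affine_euclidean[of "\<lambda>_. c" a] c by (simp add: T prod_ennreal)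
  then have "(LINT x|lebesgue. f x) = (LINT x|?D. f x)"
    by simp
  also have "\<dots> = (LINT x|distr lebesgue lebesgue T. \<bar>c\<bar> ^ DIM('a) *\<^sub>R f x)"
    using f by (intro integral_density) auto
  also have "\<dots> = \<bar>c\<bar> ^ DIM('a) *\<^sub>R (LINT x|lebesgue. f (a + c *\<^sub>R x))"
    using f by (simp add: integral_distr T_def)
  finally show ?thesis ..
qed

subsection \<open>Convolution and mollification\<close>

definition conv :: "('a::euclidean_space \<Rightarrow> real) \<Rightarrow> ('a \<Rightarrow> 'b::euclidean_space) \<Rightarrow> 'a \<Rightarrow> 'b" where
  "conv k f x = (LINT y|lebesgue. k (x - y) *\<^sub>R f y)"

lemma C_c_reflect: "k \<in> C_c \<Longrightarrow> (\<lambda>y. k (x - y)) \<in> C_c"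
  using C_c_affine[of k "-1" x] by simp

lemma conv_integrable:
  fixes f :: "'a::euclidean_space \<Rightarrow> 'b::euclidean_space"
  assumes "k \<in> C_c" "f \<in> L_loc 1"
  shows "integrable lebesgue (\<lambda>y. k (x - y) *\<^sub>R f y)"
  by (intro integrable_scaleR_C_c_L_loc_1 C_c_reflect assms)

lemma conv_add:
  fixes f g :: "'a::euclidean_space \<Rightarrow> 'b::euclidean_space"
  assumes "k \<in> C_c" "f \<in> L_loc 1" "g \<in> L_loc 1"
  shows "conv k (\<lambda>x. f x + g x) x = conv k f x + conv k g x"
  using conv_integrable[OF assms(1,2)] conv_integrable[OF assms(1,3)]
  by (simp add: conv_def scaleR_add_right)

lemma conv_bounded_linear:
  fixes f :: "'a::euclidean_space \<Rightarrow> 'b::euclidean_space" and T :: "'b \<Rightarrow> 'c::euclidean_space"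
  assumes T: "bounded_linear T" and "k \<in> C_c" "f \<in> L_loc 1"
  shows "conv k (\<lambda>y. T (f y)) x = T (conv k f x)"
  using integral_bounded_linear[OF T conv_integrable[OF assms(2,3), of x]]
  by (simp add: conv_def linear_scale bounded_linear.linear[OF T])

lemma conv_cong:
  assumes "\<And>y. k (x - y) \<noteq> 0 \<Longrightarrow> f y = g y"
  shows "conv k f x = conv k g x"
proof -
  have "k (x - y) *\<^sub>R f y = k (x - y) *\<^sub>R g y" for y
    using assms by (cases "k (x - y) = 0") auto
  then show ?thesis
    unfolding conv_def by presburger
qed

lemma conv_const:
  fixes k :: "'a::euclidean_space \<Rightarrow> real"
  assumes k: "k \<in> C_c"
  shows "conv k (\<lambda>_. c) x = (LINT y|lebesgue. k y) *\<^sub>R c"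
proof -
  have "(LINT y|lebesgue. k (x - y)) = (LINT y|lebesgue. k y)"
    using integral_lebesgue_affine[OF C_c_measurable(2)[OF k], of "-1" x] by simp
  moreover have "integrable lebesgue (\<lambda>y. k (x - y))"
    using conv_integrable[OF k L_loc_const[of "1::real"]] by simp
  ultimately show ?thesis
    by (simp add: conv_def)
qed

lemma norm_conv_le:
  fixes f :: "'a::euclidean_space \<Rightarrow> 'b::euclidean_space"
  assumes "\<And>x. 0 \<le> k x"
  shows "norm (conv k f x) \<le> conv k (\<lambda>y. norm (f y)) x"
proof -
  have "norm (conv k f x) \<le> (LINT y|lebesgue. norm (k (x - y) *\<^sub>R f y))"
    unfolding conv_def by (rule integral_norm_bound)
  then show ?thesis
    using assms by (simp add: conv_def)
qed

lemma conv_mono: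
  fixes f g :: "'a::euclidean_space \<Rightarrow> real"
  assumes "k \<in> C_c" "\<And>x. 0 \<le> k x" "f \<in> L_loc 1" "g \<in> L_loc 1" "\<And>x. f x \<le> g x"
  shows "conv k f x \<le> conv k g x"
  unfolding conv_def using assms by (intro integral_mono conv_integrable scaleR_left_mono)

lemma conv_tendsto:
  fixes f :: "'a::euclidean_space \<Rightarrow> 'b::euclidean_space"
  assumes f: "f \<in> L_loc 1" and k: "\<And>n. k n \<in> C_c"
    and bound: "\<And>n z. \<bar>k n z\<bar> \<le> B * indicator (cball 0 R) z" and lim: "\<And>z. (\<lambda>n. k n z) \<longlonglongrightarrow> k' z"
  shows "(\<lambda>n. conv (k n) f x) \<longlonglongrightarrow> conv k' f x"
  unfolding conv_def
proof (rule integral_dominated_convergence)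
  show "integrable lebesgue (\<lambda>y. B * norm (indicat_real (cball x R) y *\<^sub>R f y))"
    by (intro integrable_mult_right integrable_norm L_loc_1_integrable_cball f)
  have "norm (k n (x - y) *\<^sub>R f y) \<le> B * norm (indicat_real (cball x R) y *\<^sub>R f y)" for n y
  proof -
    have "\<bar>k n (x - y)\<bar> \<le> B * indicator (cball x R) y"
      using bound[of n "x - y"] by (simp add: indicator_def dist_norm norm_minus_commute)
    from mult_right_mono[OF this norm_ge_zero[of "f y"]] show ?thesis
      by (simp add: mult.assoc)
  qed
  then show "AE y in lebesgue. norm (k n (x - y) *\<^sub>R f y) \<le> B * norm (indicat_real (cball x R) y *\<^sub>R f y)" for n
    by simp
  show "AE y in lebesgue. (\<lambda>n. k n (x - y) *\<^sub>R f y) \<longlonglongrightarrow> k' (x - y) *\<^sub>R f y"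
    using lim by (intro AE_I2 tendsto_intros)
  show measurable_n: "(\<lambda>y. k n (x - y) *\<^sub>R f y) \<in> borel_measurable lebesgue" for n
    by (rule borel_measurable_integrable[OF conv_integrable[OF k f]])
  show "(\<lambda>y. k' (x - y) *\<^sub>R f y) \<in> borel_measurable lebesgue"
    using lim by (intro borel_measurable_LIMSEQ_metric[OF measurable_n] tendsto_intros)
qed

lemma continuous_conv:
  fixes f :: "'a::euclidean_space \<Rightarrow> 'b::euclidean_space"
  assumes k: "k \<in> C_c" and f: "f \<in> L_loc 1"
  shows "continuous_on UNIV (conv k f)"
proof (intro continuous_at_imp_continuous_on ballI continuous_at_sequentiallyI)
  fix x and s :: "nat \<Rightarrow> 'a" assume s: "s \<longlonglongrightarrow> x"
  obtain R B where B: "0 < B" "\<And>x. norm (k x) \<le> B * indicator (cball 0 R) x"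
    using C_c_bound[OF k] by metis
  obtain M where M: "\<And>n. norm (s n) \<le> M"
    using convergent_imp_bounded[OF s] by (auto simp: bounded_iff)
  have "(\<lambda>n. conv (\<lambda>z. k (s n - x + 1 *\<^sub>R z)) f x) \<longlonglongrightarrow> conv k f x"
  proof (rule conv_tendsto[OF f C_c_affine[OF k]])
    show "\<bar>k (s n - x + 1 *\<^sub>R z)\<bar> \<le> B * indicator (cball 0 (R + M + norm x)) z" for n z
    proof -
      have "norm z \<le> norm (s n - x + z) + norm (s n) + norm x"
        using norm_triangle_ineq4[of "s n - x + z" "s n - x"] norm_triangle_ineq4[of "s n" x] by simp
      then show ?thesis
        using B(1) B(2)[of "s n - x + z"] M[of n] by (cases "norm (s n - x + z) \<le> R") auto
    qed
    have "isCont k z" for z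
      using C_c_continuous[OF k, of UNIV] by (simp add: continuous_on_eq_continuous_at)
    then show "(\<lambda>n. k (s n - x + 1 *\<^sub>R z)) \<longlonglongrightarrow> k z" for z
      using s by (auto intro!: isCont_tendsto_compose[of _ k] tendsto_eq_intros)
  qed simp
  then show "(\<lambda>n. conv k f (s n)) \<longlonglongrightarrow> conv k f x"
    by (simp add: conv_def)
qed

lemma C1_0_Lipschitz:
  fixes \<phi> :: "'a::euclidean_space \<Rightarrow> real"
  assumes \<phi>: "\<phi> \<in> C1_0" and bound: "\<And>x. norm (grad \<phi> x) \<le> B"
  shows "\<bar>\<phi> x - \<phi> y\<bar> \<le> B * norm (x - y)"
proof -
  have "norm (\<phi> x - \<phi> y) \<le> B * norm (x - y)"
  proof (rule differentiable_bound[of UNIV \<phi> "\<lambda>x h. h \<bullet> grad \<phi> x"])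
    show "(\<phi> has_derivative (\<lambda>h. h \<bullet> grad \<phi> x)) (at x within UNIV)" for x
      using C1_0_GDERIV[OF \<phi>] by (simp add: gderiv_def)
    show "onorm (\<lambda>h. h \<bullet> grad \<phi> x) \<le> B" for x
    proof (rule onorm_bound)
      show "norm (h \<bullet> grad \<phi> x) \<le> B * norm h" for h
        using Cauchy_Schwarz_ineq2[of h "grad \<phi> x"] mult_left_mono[OF bound[of x] norm_ge_zero[of h]]
        by (simp add: mult.commute)
    qed (use order_trans[OF norm_ge_zero bound] in blast)
  qed auto
  then show ?thesis by simp
qed

definition linearization_error :: "('a::euclidean_space \<Rightarrow> real) \<Rightarrow> 'a \<Rightarrow> 'a \<Rightarrow> real" where
  "linearization_error \<phi> h x = (\<phi> (x + h) - \<phi> x - h \<bullet> grad \<phi> x) / norm h"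

lemma linearization_error_bound:
  fixes \<phi> :: "'a::euclidean_space \<Rightarrow> real"
  assumes \<phi>: "\<phi> \<in> C1_0"
  obtains R B where
    "\<And>h x. norm h < 1 \<Longrightarrow> \<bar>linearization_error \<phi> h x\<bar> \<le> B * indicator (cball 0 R) x"
proof -
  obtain R1 B1 where \<phi>_bound: "\<And>x. norm (\<phi> x) \<le> B1 * indicator (cball 0 R1) x"
    using C_c_bound[OF C1_0_C_c[OF \<phi>]] by metis
  obtain R2 B2 where grad_bound: "0 < B2" "\<And>x. norm (grad \<phi> x) \<le> B2 * indicator (cball 0 R2) x"
    and grad_le: "\<And>x. norm (grad \<phi> x) \<le> B2"
    using C_c_bound[OF C1_0_grad_C_c[OF \<phi>]] by metis
  have "\<bar>linearization_error \<phi> h x\<bar> \<le> 2 * B2 * indicator (cball 0 (max (R1 + 1) R2)) x"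
    if h: "norm h < 1" for h x
  proof (cases "norm x \<le> max (R1 + 1) R2")
    case True
    have "\<bar>\<phi> (x + h) - \<phi> x\<bar> \<le> B2 * norm h"
      using C1_0_Lipschitz[OF \<phi> grad_le, of "x + h" x] by simp
    moreover have "\<bar>h \<bullet> grad \<phi> x\<bar> \<le> B2 * norm h"
      using Cauchy_Schwarz_ineq2[of h "grad \<phi> x"] mult_left_mono[OF grad_le[of x] norm_ge_zero[of h]]
      by (simp add: mult.commute)
    ultimately have "\<bar>\<phi> (x + h) - \<phi> x - h \<bullet> grad \<phi> x\<bar> \<le> 2 * B2 * norm h"
      by linarith
    then show ?thesis
      using True grad_bound(1) by (cases "h = 0") (simp_all add: linearization_error_def divide_le_eq)
  next
    case False
    then have "R1 < norm (x + h)" "R1 < norm x" "R2 < norm x"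
      using h norm_triangle_ineq4[of "x + h" h] by auto
    then show ?thesis
      using False \<phi>_bound[of "x + h"] \<phi>_bound[of x] grad_bound(2)[of x]
      by (simp add: linearization_error_def)
  qed
  then show thesis by (rule that)
qed

lemma linearization_error_C_c:
  fixes \<phi> :: "'a::euclidean_space \<Rightarrow> real"
  assumes \<phi>: "\<phi> \<in> C1_0" and h: "norm h < 1"
  shows "linearization_error \<phi> h \<in> C_c"
proof -
  obtain R B where "\<And>x. \<bar>linearization_error \<phi> h x\<bar> \<le> B * indicator (cball 0 R) x"
    using linearization_error_bound[OF \<phi>] h by metis
  then have "linearization_error \<phi> h x = 0" if "R < norm x" for x
    using that by (metis abs_le_zero_iff indicator_simps(2) linorder_not_le mem_cball_0 mult_zero_right)
  moreover have "continuous_on UNIV (linearization_error \<phi> h)"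
    using C1_0_D(2,3)[OF \<phi>, THEN C_c_continuous]
    unfolding linearization_error_def[abs_def] divide_inverse
    by (intro continuous_intros continuous_on_compose2[OF C_c_continuous[OF C1_0_C_c[OF \<phi>], of UNIV]]) auto
  ultimately show ?thesis
    by (auto simp: C_c_def)
qed

lemma linearization_error_tendsto:
  fixes \<phi> :: "'a::euclidean_space \<Rightarrow> real"
  assumes "\<phi> \<in> C1_0"
  shows "((\<lambda>h. linearization_error \<phi> h x) \<longlongrightarrow> 0) (at 0)"
  using C1_0_GDERIV[OF assms, of x]
  by (intro tendsto_rabs_zero_cancel[of "\<lambda>h. linearization_error \<phi> h x"])
    (simp add: gderiv_def has_derivative_at linearization_error_def)

lemma conv_linearization_error:
  fixes f :: "'a::euclidean_space \<Rightarrow> real"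
  assumes k: "k \<in> C1_0" and f: "f \<in> L_loc 1"
  shows "conv (linearization_error k h) f x
    = (conv k f (x + h) - conv k f x - h \<bullet> (LINT y|lebesgue. f y *\<^sub>R grad k (x - y))) / norm h"
proof -
  have "integrable lebesgue (\<lambda>y. f y *\<^sub>R grad k (x - y))"
    by (intro integrable_scaleR_L_loc_1_C_c f C_c_reflect C1_0_grad_C_c k)
  moreover have "integrable lebesgue (\<lambda>y. k (z - y) * f y)" for z
    using conv_integrable[OF C1_0_C_c[OF k] f] by simp
  ultimately have "(conv k f (x + h) - conv k f x - h \<bullet> (LINT y|lebesgue. f y *\<^sub>R grad k (x - y))) / norm h
      = (LINT y|lebesgue. (k (x + h - y) * f y - k (x - y) * f y - h \<bullet> (f y *\<^sub>R grad k (x - y))) / norm h)"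
    by (simp add: conv_def del: inner_scaleR_right)
  also have "\<dots> = conv (linearization_error k h) f x"
    by (simp add: conv_def linearization_error_def diff_add_eq right_diff_distrib mult.commute)
  finally show ?thesis ..
qed

lemma GDERIV_conv:
  fixes f :: "'a::euclidean_space \<Rightarrow> real"
  assumes k: "k \<in> C1_0" and f: "f \<in> L_loc 1"
  shows "GDERIV (conv k f) x :> (LINT y|lebesgue. f y *\<^sub>R grad k (x - y))"
proof -
  obtain R B where bound:
    "\<And>h x. norm h < 1 \<Longrightarrow> \<bar>linearization_error k h x\<bar> \<le> B * indicator (cball 0 R) x"
    using linearization_error_bound[OF k] by metis
  have "((\<lambda>h. conv (linearization_error k h) f x) \<longlongrightarrow> 0) (at 0 within ball 0 1)"
    unfolding tendsto_at_iff_sequentially comp_def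
  proof (intro allI impI)
    fix s :: "nat \<Rightarrow> 'a" assume s: "\<forall>n. s n \<in> ball 0 1 - {0}" "s \<longlonglongrightarrow> 0"
    have "(\<lambda>n. linearization_error k (s n) z) \<longlonglongrightarrow> 0" for z
      using linearization_error_tendsto[OF k, of z] s by (simp add: tendsto_at_iff_sequentially comp_def)
    then have "(\<lambda>n. conv (linearization_error k (s n)) f x) \<longlonglongrightarrow> conv (\<lambda>_. 0) f x"
      using s(1) by (intro conv_tendsto[OF f linearization_error_C_c[OF k] bound]) auto
    then show "(\<lambda>n. conv (linearization_error k (s n)) f x) \<longlonglongrightarrow> 0"
      by (simp add: conv_def)
  qed
  then have "((\<lambda>h. \<bar>conv (linearization_error k h) f x\<bar>) \<longlongrightarrow> 0) (at 0)"
    by (simp add: at_within_open[of _ "ball 0 1"] tendsto_rabs_zero)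
  then show ?thesis
    by (simp add: gderiv_def has_derivative_at bounded_linear_inner_left conv_linearization_error[OF k f])
qed

text \<open>Convolving a constant with \<open>\<phi>\<close> gives a constant, whose gradient is the integral of \<open>grad \<phi>\<close>.\<close>

lemma integral_grad_C1_0:
  fixes \<phi> :: "'a::euclidean_space \<Rightarrow> real"
  assumes \<phi>: "\<phi> \<in> C1_0"
  shows "(LINT x|lebesgue. grad \<phi> x) = 0"
proof -
  have "conv \<phi> (\<lambda>_. 1) = (\<lambda>_. LINT y|lebesgue. \<phi> y)"
    using conv_const[OF C1_0_C_c[OF \<phi>], of "1::real"] by auto
  then have "(LINT y|lebesgue. grad \<phi> (0 - y)) = 0"
    using GDERIV_unique[OF GDERIV_conv[OF \<phi> L_loc_const[of 1], of 0]] GDERIV_const[of "LINT y|lebesgue. \<phi> y" 0]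
    by simp
  then show ?thesis
    using integral_lebesgue_affine[OF C_c_measurable(2)[OF C1_0_grad_C_c[OF \<phi>]], of "-1" 0] by simp
qed

lemma has_weak_gradient_const: "has_weak_gradient (\<lambda>_::'a::euclidean_space. c) (\<lambda>_. 0)"
  unfolding has_weak_gradient_def
proof (intro conjI ballI)
  fix \<phi> :: "'a \<Rightarrow> real" and i :: 'a assume \<phi>: "\<phi> \<in> C1_0"
  have "integrable lebesgue (grad \<phi>)"
    using integrable_scaleR_L_loc_1_C_c[OF L_loc_const[of 1] C1_0_grad_C_c[OF \<phi>]] by simp
  then have "(LINT x|lebesgue. grad \<phi> x \<bullet> i) = 0"
    by (simp add: integral_grad_C1_0[OF \<phi>])
  then show "(LINT x|lebesgue. c * (grad \<phi> x \<bullet> i)) = - (LINT x|lebesgue. (0 \<bullet> i) * \<phi> x)"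
    by simp
qed (rule L_loc_const)+

lemma has_weak_gradient_diff:
  fixes u v :: "'a::euclidean_space \<Rightarrow> real"
  assumes u: "has_weak_gradient u U" and v: "has_weak_gradient v V"
  shows "has_weak_gradient (\<lambda>x. u x - v x) (\<lambda>x. U x - V x)"
  unfolding has_weak_gradient_def
proof (intro conjI ballI)
  have L_loc: "u \<in> L_loc 1" "v \<in> L_loc 1" "U \<in> L_loc 1" "V \<in> L_loc 1"
    using u v by (auto simp: has_weak_gradient_def)
  then show "(\<lambda>x. u x - v x) \<in> L_loc 1" "(\<lambda>x. U x - V x) \<in> L_loc 1"
    by (auto intro: L_loc_diff)
  fix \<phi> :: "'a \<Rightarrow> real" and i :: 'a assume \<phi>: "\<phi> \<in> C1_0" and i: "i \<in> Basis"
  have "integrable lebesgue (\<lambda>x. f x * (grad \<phi> x \<bullet> i))" if "f \<in> L_loc 1" for f :: "'a \<Rightarrow> real"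
    using integrable_inner_left[of i lebesgue "\<lambda>x. f x *\<^sub>R grad \<phi> x"]
      integrable_scaleR_L_loc_1_C_c[OF that C1_0_grad_C_c[OF \<phi>]] by simp
  moreover have "integrable lebesgue (\<lambda>x. (f x \<bullet> i) * \<phi> x)" if "f \<in> L_loc 1" for f :: "'a \<Rightarrow> 'a"
    using integrable_inner_left[of i lebesgue "\<lambda>x. \<phi> x *\<^sub>R f x"]
      integrable_scaleR_C_c_L_loc_1[OF C1_0_C_c[OF \<phi>] that] by (simp add: mult.commute)
  ultimately show "(LINT x|lebesgue. (u x - v x) * (grad \<phi> x \<bullet> i))
      = - (LINT x|lebesgue. ((U x - V x) \<bullet> i) * \<phi> x)"
    using u v \<phi> i L_loc by (simp add: has_weak_gradient_def left_diff_distrib inner_diff_left)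
qed

lemma GDERIV_conv_weak_gradient:
  fixes w :: "'a::euclidean_space \<Rightarrow> real"
  assumes W: "has_weak_gradient w W" and k: "k \<in> C1_0"
  shows "GDERIV (conv k w) x :> conv k W x"
proof -
  have w_loc: "w \<in> L_loc 1" and W_loc: "W \<in> L_loc 1"
    using W by (auto simp: has_weak_gradient_def)
  have reflect: "(\<lambda>y. k (x - y)) \<in> C1_0" "grad (\<lambda>y. k (x - y)) y = - grad k (x - y)" for y
    using C1_0_affine[OF k, of "-1" x] by simp_all
  have "(LINT y|lebesgue. w y *\<^sub>R grad k (x - y)) = conv k W x"
  proof (rule euclidean_eqI)
    fix i :: 'a assume i: "i \<in> Basis"
    have "(LINT y|lebesgue. w y *\<^sub>R grad k (x - y)) \<bullet> i = (LINT y|lebesgue. (w y *\<^sub>R grad k (x - y)) \<bullet> i)"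
      by (intro integral_inner_left[symmetric] integrable_scaleR_L_loc_1_C_c w_loc C_c_reflect C1_0_grad_C_c k)
    also have "\<dots> = - (LINT y|lebesgue. w y * (grad (\<lambda>y. k (x - y)) y \<bullet> i))"
      by (simp add: reflect)
    also have "\<dots> = (LINT y|lebesgue. (W y \<bullet> i) * k (x - y))"
      using W reflect(1) i by (simp add: has_weak_gradient_def)
    also have "\<dots> = (LINT y|lebesgue. (k (x - y) *\<^sub>R W y) \<bullet> i)"
      by (simp add: mult.commute)
    also have "\<dots> = conv k W x \<bullet> i"
      unfolding conv_def by (intro integral_inner_left conv_integrable C1_0_C_c k W_loc)
    finally show "(LINT y|lebesgue. w y *\<^sub>R grad k (x - y)) \<bullet> i = conv k W x \<bullet> i" .
  qed
  with GDERIV_conv[OF k w_loc, of x] show ?thesis by simp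
qed

definition mollifier :: "real \<Rightarrow> ('a::euclidean_space \<Rightarrow> real) \<Rightarrow> bool" where
  "mollifier r k \<longleftrightarrow> k \<in> C1_0 \<and> (\<forall>x. 0 \<le> k x) \<and> (\<forall>x. r \<le> norm x \<longrightarrow> k x = 0) \<and>
     (LINT x|lebesgue. k x) = 1"

lemma mollifier_C_c: "mollifier r k \<Longrightarrow> k \<in> C_c"
  by (simp add: mollifier_def C1_0_C_c)

lemma mollifier_exists:
  fixes r :: real
  assumes r: "0 < r"
  obtains k :: "'a::euclidean_space \<Rightarrow> real" where "mollifier r k"
proof -
  obtain \<xi> :: "'a \<Rightarrow> real" where \<xi>: "\<xi> \<in> C1_0" "\<And>x. 0 \<le> \<xi> x"
    "\<And>x. norm x \<le> 1 \<Longrightarrow> \<xi> x = 1" "\<And>x. 2 \<le> norm x \<Longrightarrow> \<xi> x = 0"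
    using C1_0_bump_exists by metis
  define k0 where "k0 x = \<xi> (0 + (2 / r) *\<^sub>R x)" for x
  have k0: "k0 \<in> C1_0"
    using C1_0_affine(1)[OF \<xi>(1), of "2 / r" 0] r by (simp add: k0_def[abs_def])
  have "0 < (LINT x|lebesgue. indicat_real (cball (0::'a) (r / 2)) x)"
    using content_cball_pos[of "r / 2" "0::'a"] r by simp
  also have "\<dots> \<le> (LINT x|lebesgue. k0 x)"
  proof (rule integral_mono)
    show "integrable lebesgue (indicat_real (cball (0::'a) (r / 2)))"
      by (intro integrable_real_indicator) (auto intro: emeasure_bounded_finite[unfolded infinity_ennreal_def])
    show "integrable lebesgue k0"
      using integrable_mult_L_loc_1_C_c[OF L_loc_const[of "1::real"] C1_0_C_c[OF k0]] by simp
    show "indicat_real (cball 0 (r / 2)) x \<le> k0 x" for x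
      using \<xi>(2,3) r by (simp add: k0_def indicator_def field_simps)
  qed
  finally have pos: "0 < (LINT x|lebesgue. k0 x)" .
  define c where "c = 1 / (LINT x|lebesgue. k0 x)"
  have "(\<lambda>x. c * k0 x) \<in> C1_0"
    by (rule C1_0_mult(1)[OF GDERIV_const continuous_on_const k0])
  moreover have "k0 x = 0" if "r \<le> norm x" for x
    using \<xi>(4) that r by (simp add: k0_def le_divide_eq)
  ultimately have "mollifier r (\<lambda>x. c * k0 x)"
    using pos \<xi>(2) by (simp add: mollifier_def c_def k0_def)
  then show thesis by (rule that)
qed

lemma conv_mollifier_const: "mollifier r k \<Longrightarrow> conv k (\<lambda>_. c) x = c"
  using conv_const[OF mollifier_C_c, of r k c x] by (simp add: mollifier_def)

lemma conv_mollifier_cong: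
  assumes "mollifier r k" "\<And>y. dist x y < r \<Longrightarrow> f y = g y"
  shows "conv k f x = conv k g x"
proof (rule conv_cong)
  fix y assume "k (x - y) \<noteq> 0"
  then have "norm (x - y) < r"
    using assms(1) by (meson linorder_not_le mollifier_def)
  then show "f y = g y"
    using assms(2) by (simp add: dist_norm)
qed

lemma powr_above_tangent:
  fixes a m p :: real
  assumes "0 \<le> a" "0 \<le> m" "1 \<le> p"
  shows "m powr p + p * m powr (p - 1) * (a - m) \<le> a powr p"
proof (cases "p = 1")
  case True
  then show ?thesis using assms by (cases "m = 0") auto
next
  case False
  then have p: "1 < p" using assms by simp
  have "a * m powr (p - 1) \<le> a powr p / p + (m powr (p - 1)) powr (p / (p - 1)) / (p / (p - 1))"
    using p assms by (intro Youngs_inequality) (auto simp: field_simps)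
  also have "(m powr (p - 1)) powr (p / (p - 1)) = m powr p"
    using p by (simp add: powr_powr)
  finally have "p * (a * m powr (p - 1)) \<le> p * (a powr p / p + m powr p / (p / (p - 1)))"
    using p by (intro mult_left_mono) auto
  also have "\<dots> = a powr p + (p - 1) * m powr p"
    using p by (simp add: field_simps)
  finally show ?thesis
    using powr_mult_base[of m "p - 1"] assms(2) by (simp add: algebra_simps)
qed

text \<open>Jensen's inequality: integrate the tangent of \<open>t\<^sup>p\<close> at the average of \<open>norm f\<close>.\<close>

lemma norm_conv_powr_le:
  fixes f :: "'a::euclidean_space \<Rightarrow> 'b::euclidean_space"
  assumes k: "mollifier r k" and f: "f \<in> L_loc p" and p: "1 \<le> p"
  shows "norm (conv k f x) powr p \<le> conv k (\<lambda>y. norm (f y) powr p) x"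
proof -
  note k_C_c = mollifier_C_c[OF k]
  have k_nonneg: "0 \<le> k x" for x
    using k by (simp add: mollifier_def)
  have norm_f: "(\<lambda>y. norm (f y)) \<in> L_loc 1"
    using L_loc_norm_powr[OF L_loc_mono[OF f, of 1]] p by simp
  define m where "m = conv k (\<lambda>y. norm (f y)) x"
  have norm_le: "norm (conv k f x) \<le> m"
    unfolding m_def by (rule norm_conv_le[OF k_nonneg])
  define slope where "slope = p * m powr (p - 1)"
  define tangent where "tangent t = (m powr p - slope * m) + slope *\<^sub>R t" for t
  have scaled: "(\<lambda>y. slope *\<^sub>R norm (f y)) \<in> L_loc 1"
    by (rule L_loc_1_scaleR[OF norm_f])
  have "norm (conv k f x) powr p \<le> m powr p"
    using norm_le p by (intro powr_mono2) auto
  also have "\<dots> = conv k (\<lambda>y. tangent (norm (f y))) x"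
    unfolding tangent_def conv_add[OF k_C_c L_loc_const scaled] conv_mollifier_const[OF k]
      conv_bounded_linear[OF bounded_linear_scaleR_right k_C_c norm_f]
    by (simp flip: m_def)
  also have "\<dots> \<le> conv k (\<lambda>y. norm (f y) powr p) x"
  proof (rule conv_mono[OF k_C_c k_nonneg])
    show "tangent (norm (f y)) \<le> norm (f y) powr p" for y
      using powr_above_tangent[of "norm (f y)" m p] order_trans[OF norm_ge_zero norm_le] p
      by (simp add: tangent_def slope_def algebra_simps)
  qed (use L_loc_norm_powr[OF f] L_loc_1_add[OF L_loc_const scaled] in \<open>simp_all add: tangent_def\<close>)
  finally show ?thesis .
qed

lemma lebesgue_borel_representative:
  fixes f :: "'a::euclidean_space \<Rightarrow> 'b::euclidean_space"
  assumes f: "f \<in> borel_measurable lebesgue"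
  obtains g where "g \<in> borel_measurable borel" "AE x in lebesgue. f x = g x"
proof -
  have "\<exists>g\<in>borel_measurable lborel. AE x in lborel. f x \<bullet> b = g x" for b
    using f by (intro completion_ex_borel_measurable_real) auto
  then obtain g where g: "\<And>b. g b \<in> borel_measurable lborel" "\<And>b. AE x in lborel. f x \<bullet> b = g b x"
    by metis
  have [measurable]: "g b \<in> borel_measurable borel" for b using g(1)[of b] by simp
  have "AE x in lborel. \<forall>b\<in>Basis. f x \<bullet> b = g b x"
    using g(2) by (simp add: AE_ball_countable countable_finite)
  then have "AE x in lborel. f x = (\<Sum>b\<in>Basis. g b x *\<^sub>R b)"
    by eventually_elim (metis (no_types, lifting) euclidean_representation sum.cong)
  moreover have "(\<lambda>x. \<Sum>b\<in>Basis. g b x *\<^sub>R b) \<in> borel_measurable borel" by measurable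
  ultimately show thesis using that AE_completion by blast
qed

lemma conv_cong_AE:
  fixes f g :: "'a::euclidean_space \<Rightarrow> 'b::euclidean_space"
  assumes "k \<in> borel_measurable borel" "f \<in> borel_measurable lebesgue" "g \<in> borel_measurable lebesgue"
    and "AE x in lebesgue. f x = g x"
  shows "conv k f x = conv k g x"
proof -
  have [measurable]: "(\<lambda>y. k (x - y)) \<in> borel_measurable lebesgue"
    using assms(1) by (intro measurable_completion) simp
  note [measurable] = assms(2,3)
  show ?thesis
    unfolding conv_def using assms(4) by (intro integral_cong_AE) (auto elim: eventually_mono)
qed

lemma mollifier_lborel_integral:
  assumes "mollifier r k"
  shows "integrable lborel (\<lambda>x. k (x - y))" "(\<integral>x. k (x - y) \<partial>lborel) = 1"
proof -
  have translate: "(\<lambda>x. k (x - y)) \<in> C_c"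
    using C_c_affine[OF mollifier_C_c[OF assms], of 1 "- y"] by simp
  then have "integrable lebesgue (\<lambda>x. k (x - y))"
    using integrable_mult_L_loc_1_C_c[OF L_loc_const[of "1::real"]] by simp
  then show "integrable lborel (\<lambda>x. k (x - y))"
    using C_c_measurable(1)[OF translate] by (simp add: integrable_completion)
  have "(LINT x|lebesgue. k (x - y)) = 1"
    using integral_lebesgue_affine[OF C_c_measurable(2)[OF mollifier_C_c[OF assms]], of 1 "- y"] assms
    by (simp add: mollifier_def)
  then show "(\<integral>x. k (x - y) \<partial>lborel) = 1"
    using C_c_measurable(1)[OF translate] by (simp add: integral_completion)
qed

lemma conv_lborel_Fubini:
  fixes f :: "'a::euclidean_space \<Rightarrow> 'b::euclidean_space"
  assumes k: "mollifier r k" and f: "integrable lborel f"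
  shows "integrable lborel (conv k f)" "(\<integral>x. conv k f x \<partial>lborel) = (\<integral>x. f x \<partial>lborel)"
proof -
  note k_lborel = mollifier_lborel_integral[OF k]
  have [measurable]: "k \<in> borel_measurable borel" "f \<in> borel_measurable borel"
    using C_c_measurable(1)[OF mollifier_C_c[OF k]] f by auto
  have "integrable (lborel \<Otimes>\<^sub>M lborel) (\<lambda>(y, x). k (x - y) *\<^sub>R f y)"
  proof (rule lborel_pair.Fubini_integrable)
    have "(\<lambda>y. \<integral>x. norm (case (y, x) of (y, x) \<Rightarrow> k (x - y) *\<^sub>R f y) \<partial>lborel) = (\<lambda>y. norm (f y))"
      using k k_lborel by (auto simp: mollifier_def)
    then show "integrable lborel (\<lambda>y. \<integral>x. norm (case (y, x) of (y, x) \<Rightarrow> k (x - y) *\<^sub>R f y) \<partial>lborel)"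
      using f by simp
  qed (use k_lborel in auto)
  then have product: "integrable (lborel \<Otimes>\<^sub>M lborel) (\<lambda>(x, y). k (x - y) *\<^sub>R f y)"
    using lborel_pair.integrable_product_swap[of "\<lambda>(y, x). k (x - y) *\<^sub>R f y"] by (simp add: case_prod_beta')
  have conv: "conv k f x = (\<integral>y. k (x - y) *\<^sub>R f y \<partial>lborel)" for x
    unfolding conv_def by (intro integral_completion) simp
  show "integrable lborel (conv k f)"
    using lborel_pair.integrable_fst[OF product] by (simp add: conv[abs_def])
  have "(\<integral>x. conv k f x \<partial>lborel) = (\<integral>y. (\<integral>x. k (x - y) *\<^sub>R f y \<partial>lborel) \<partial>lborel)"
    using lborel_pair.Fubini_integral[OF product] by (simp add: conv)
  also have "\<dots> = (\<integral>y. f y \<partial>lborel)"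
    using k_lborel by simp
  finally show "(\<integral>x. conv k f x \<partial>lborel) = (\<integral>x. f x \<partial>lborel)" .
qed

lemma integrable_conv:
  fixes f :: "'a::euclidean_space \<Rightarrow> 'b::euclidean_space"
  assumes k: "mollifier r k" and f: "integrable lebesgue f"
  shows "integrable lebesgue (conv k f)"
    and integral_conv: "(LINT x|lebesgue. conv k f x) = (LINT x|lebesgue. f x)"
proof -
  obtain g where g [measurable]: "g \<in> borel_measurable borel" and ae: "AE x in lebesgue. f x = g x"
    using lebesgue_borel_representative borel_measurable_integrable[OF f] by blast
  have g_lebesgue: "g \<in> borel_measurable lebesgue"
    using g by (auto intro: measurable_completion)
  have conv: "conv k f = conv k g"
    using C_c_measurable(1)[OF mollifier_C_c[OF k]] borel_measurable_integrable[OF f] g_lebesgue ae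
    by (intro ext conv_cong_AE)
  have "integrable lebesgue g"
    by (rule integrable_cong_AE_imp[OF f g_lebesgue ae])
  then have "integrable lborel g"
    by (simp add: integrable_completion)
  note Fubini = conv_lborel_Fubini[OF k this]
  then have conv_measurable: "conv k g \<in> borel_measurable lborel"
    by auto
  show "integrable lebesgue (conv k f)"
    using Fubini(1) conv_measurable unfolding conv by (simp add: integrable_completion)
  have "(LINT x|lebesgue. conv k f x) = (\<integral>x. g x \<partial>lborel)"
    using Fubini(2) conv_measurable by (simp add: conv integral_completion)
  also have "\<dots> = (LINT x|lebesgue. g x)"
    by (simp add: integral_completion)
  also have "\<dots> = (LINT x|lebesgue. f x)"
    using ae f g_lebesgue by (intro integral_cong_AE) auto
  finally show "(LINT x|lebesgue. conv k f x) = (LINT x|lebesgue. f x)" .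
qed

lemma integral_norm_conv_le:
  fixes f :: "'a::euclidean_space \<Rightarrow> 'b::euclidean_space"
  assumes k: "mollifier r k" and f: "integrable lebesgue f"
  shows "(LINT x|lebesgue. norm (conv k f x)) \<le> (LINT x|lebesgue. norm (f x))"
proof -
  have "(LINT x|lebesgue. norm (conv k f x)) \<le> (LINT x|lebesgue. conv k (\<lambda>y. norm (f y)) x)"
    using k
    by (intro integral_mono integrable_norm integrable_conv[OF k] f norm_conv_le) (simp add: mollifier_def)
  also have "\<dots> = (LINT x|lebesgue. norm (f x))"
    by (rule integral_conv[OF k integrable_norm[OF f]])
  finally show ?thesis .
qed

lemma integral_norm_conv_diff_add_le:
  fixes f g :: "'a::euclidean_space \<Rightarrow> 'b::euclidean_space"
  assumes k: "mollifier r k" and f: "integrable lebesgue f" and g: "integrable lebesgue g"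
  shows "(LINT x|lebesgue. norm (conv k (\<lambda>x. f x + g x) x - (f x + g x)))
    \<le> (LINT x|lebesgue. norm (conv k f x - f x)) + (LINT x|lebesgue. norm (conv k g x - g x))"
proof -
  note conv = integrable_conv[OF k f] integrable_conv[OF k g]
    integrable_conv[OF k Bochner_Integration.integrable_add[OF f g]]
  have "(LINT x|lebesgue. norm (conv k (\<lambda>x. f x + g x) x - (f x + g x)))
      \<le> (LINT x|lebesgue. norm (conv k f x - f x) + norm (conv k g x - g x))"
  proof (rule integral_mono)
    show "norm (conv k (\<lambda>x. f x + g x) x - (f x + g x))
        \<le> norm (conv k f x - f x) + norm (conv k g x - g x)" for x
      using norm_triangle_ineq[of "conv k f x - f x" "conv k g x - g x"]
      by (simp add: conv_add mollifier_C_c[OF k] integrable_imp_L_loc_1 f g algebra_simps)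
  qed (use conv f g in auto)
  then show ?thesis
    using conv f g by simp
qed

lemma integral_norm_conv_diff_le:
  fixes f :: "'a::euclidean_space \<Rightarrow> 'b::euclidean_space"
  assumes k: "mollifier r k" and f: "integrable lebesgue f"
  shows "(LINT x|lebesgue. norm (conv k f x - f x)) \<le> 2 * (LINT x|lebesgue. norm (f x))"
proof -
  have "(LINT x|lebesgue. norm (conv k f x - f x)) \<le> (LINT x|lebesgue. norm (conv k f x) + norm (f x))"
    using integrable_conv[OF k f] f by (intro integral_mono norm_triangle_ineq4) auto
  then show ?thesis
    using integral_norm_conv_le[OF k f] integrable_conv[OF k f] f by simp
qed

lemma indicator_L1_approx_open:
  fixes A :: "'a::euclidean_space set" and c :: "'b::euclidean_space"
  assumes A: "A \<in> lmeasurable" and e: "0 < e"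
  obtains U where "open U" "U \<in> lmeasurable"
    "(LINT x|lebesgue. norm (indicat_real A x *\<^sub>R c - indicat_real U x *\<^sub>R c)) < e"
proof -
  define d where "d = e / (norm c + 1)"
  have d: "0 < d" "norm c * d < e"
    using e add_nonneg_pos[of "norm c" 1] by (auto simp: d_def divide_simps mult.commute algebra_simps)
  obtain U where U: "open U" "A \<subseteq> U" "U - A \<in> lmeasurable" "emeasure lebesgue (U - A) < ennreal d"
    using sets_lebesgue_outer_open[OF fmeasurableD[OF A] d(1)] by metis
  have "(LINT x|lebesgue. norm (indicat_real A x *\<^sub>R c - indicat_real U x *\<^sub>R c))
      = (LINT x|lebesgue. norm c * indicat_real (U - A) x)"
    using U(2) by (intro Bochner_Integration.integral_cong) (auto simp: indicator_def)
  also have "\<dots> = norm c * measure lebesgue (U - A)"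
    by simp
  also have "\<dots> \<le> norm c * d"
    using U(3,4) d(1) by (intro mult_left_mono) (auto simp: emeasure_eq_measure2 ennreal_less_iff)
  finally have "(LINT x|lebesgue. norm (indicat_real A x *\<^sub>R c - indicat_real U x *\<^sub>R c)) < e"
    using d(2) by simp
  moreover have "A \<union> (U - A) = U"
    using U(2) by auto
  then have "U \<in> lmeasurable"
    using fmeasurable.Un[OF A U(3)] by simp
  ultimately show thesis
    using U(1) by (intro that)
qed

lemma integral_norm_diff_tendsto_0:
  fixes f :: "'a \<Rightarrow> 'b::{banach, second_countable_topology}"
  assumes s: "\<And>i. integrable M (s i)" and f: "integrable M f" and w: "integrable M w"
    and tendsto: "AE x in M. (\<lambda>i. s i x) \<longlonglongrightarrow> f x" and bound: "\<And>i. AE x in M. norm (s i x) \<le> w x"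
  shows "(\<lambda>i. \<integral>x. norm (f x - s i x) \<partial>M) \<longlonglongrightarrow> 0"
proof -
  have "(\<lambda>i. \<integral>x. norm (f x - s i x) \<partial>M) \<longlonglongrightarrow> (\<integral>x. 0 \<partial>M)"
  proof (rule integral_dominated_convergence)
    show "integrable M (\<lambda>x. norm (f x) + w x)"
      using f w by simp
    show "AE x in M. norm (norm (f x - s i x)) \<le> norm (f x) + w x" for i
      using bound[of i] by eventually_elim (simp add: norm_triangle_le_diff)
    show "AE x in M. (\<lambda>i. norm (f x - s i x)) \<longlonglongrightarrow> 0"
      using tendsto by eventually_elim (auto intro!: tendsto_eq_intros)
  qed (use s f in auto)
  then show ?thesis by simp
qed

lemma integrable_lebesgue_induct [consumes 1, case_names indicator add approx]:
  fixes f :: "'a::euclidean_space \<Rightarrow> 'b::euclidean_space"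
  assumes f: "integrable lebesgue f"
    and indicator: "\<And>U c. open U \<Longrightarrow> U \<in> lmeasurable \<Longrightarrow> P (\<lambda>x. indicat_real U x *\<^sub>R c)"
    and add: "\<And>f g. integrable lebesgue f \<Longrightarrow> P f \<Longrightarrow> integrable lebesgue g \<Longrightarrow> P g \<Longrightarrow> P (\<lambda>x. f x + g x)"
    and approx: "\<And>f. integrable lebesgue f \<Longrightarrow>
      (\<And>e. 0 < e \<Longrightarrow> \<exists>g. integrable lebesgue g \<and> P g \<and> (LINT x|lebesgue. norm (f x - g x)) < e) \<Longrightarrow> P f"
  shows "P f"
  using f
proof (induction rule: integrable_induct)
  case (base A c)
  then have A: "A \<in> lmeasurable"
    by (simp add: fmeasurable_def)
  have integrable: "integrable lebesgue (\<lambda>x. indicat_real U x *\<^sub>R c)" if "U \<in> lmeasurable" for U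
    using that by (intro integrable_scaleR_left integrable_real_indicator) (auto simp: fmeasurable_def)
  show ?case
  proof (rule approx[OF integrable[OF A]])
    fix e :: real assume "0 < e"
    then obtain U where U: "open U" "U \<in> lmeasurable"
      "(LINT x|lebesgue. norm (indicat_real A x *\<^sub>R c - indicat_real U x *\<^sub>R c)) < e"
      using indicator_L1_approx_open[OF A] by metis
    then show "\<exists>g. integrable lebesgue g \<and> P g \<and> (LINT x|lebesgue. norm (indicat_real A x *\<^sub>R c - g x)) < e"
      using indicator[OF U(1,2), of c] integrable[OF U(2)] by blast
  qed
next
  case (lim f s)
  show ?case
  proof (rule approx[OF lim.hyps(4)])
    fix e :: real assume e: "0 < e"
    have "(\<lambda>i. LINT x|lebesgue. norm (f x - s i x)) \<longlonglongrightarrow> 0"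
      using lim.hyps by (intro integral_norm_diff_tendsto_0[where w = "\<lambda>x. 2 * norm (f x)"]) auto
    then obtain i where "(LINT x|lebesgue. norm (f x - s i x)) < e"
      using order_tendstoD(2)[of _ 0 sequentially e] e by (auto simp: eventually_sequentially)
    then show "\<exists>g. integrable lebesgue g \<and> P g \<and> (LINT x|lebesgue. norm (f x - g x)) < e"
      using lim.hyps(1) lim.IH by blast
  qed
qed (rule add)

lemma integral_abs_diff_eq_twice_pos_part:
  fixes f g :: "'a \<Rightarrow> real"
  assumes "integrable M f" "integrable M g" "(\<integral>x. f x \<partial>M) = (\<integral>x. g x \<partial>M)"
  shows "(\<integral>x. \<bar>f x - g x\<bar> \<partial>M) = 2 * (\<integral>x. max 0 (g x - f x) \<partial>M)"
proof -
  have "(\<integral>x. \<bar>f x - g x\<bar> \<partial>M) = (\<integral>x. 2 * max 0 (g x - f x) + (f x - g x) \<partial>M)"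
    by (intro Bochner_Integration.integral_cong) (auto simp: max_def abs_if)
  also have "\<dots> = 2 * (\<integral>x. max 0 (g x - f x) \<partial>M)"
    using assms by simp
  finally show ?thesis .
qed

text \<open>Mollification preserves the integral, so it suffices to bound the positive part of
  \<open>indicator U - conv k (indicator U)\<close>. For open \<open>U\<close> this vanishes pointwise in the limit.\<close>

lemma conv_indicator_open_tendsto:
  fixes U :: "'a::euclidean_space set" and k :: "nat \<Rightarrow> 'a \<Rightarrow> real"
  assumes k: "\<And>n. mollifier (r n) (k n)" and r: "r \<longlonglongrightarrow> 0" and U: "open U" "U \<in> lmeasurable"
  shows "(\<lambda>n. LINT x|lebesgue. \<bar>conv (k n) (indicat_real U) x - indicat_real U x\<bar>) \<longlonglongrightarrow> 0"
proof -
  let ?I = "indicat_real U"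
  define deficit where "deficit n x = max 0 (?I x - conv (k n) ?I x)" for n x
  have int: "integrable lebesgue ?I"
    using U(2) by (intro integrable_real_indicator) (auto simp: fmeasurable_def)
  note int_conv = integrable_conv[OF k int]
  have nonneg: "0 \<le> conv (k n) ?I x" for n x
    unfolding conv_def using k by (intro Bochner_Integration.integral_nonneg) (auto simp: mollifier_def)
  have L1_eq: "(LINT x|lebesgue. \<bar>conv (k n) ?I x - ?I x\<bar>) = 2 * (LINT x|lebesgue. deficit n x)" for n
    unfolding deficit_def by (rule integral_abs_diff_eq_twice_pos_part[OF int_conv(1) int int_conv(2)])
  have deficit_vanishes: "\<forall>\<^sub>F n in sequentially. deficit n x = 0" for x
  proof (cases "x \<in> U")
    case True
    then obtain e where e: "e > 0" "ball x e \<subseteq> U"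
      using U(1) by (auto simp: open_contains_ball)
    from order_tendstoD(2)[OF r e(1)] show ?thesis
    proof eventually_elim
      case (elim n)
      then have "conv (k n) ?I x = conv (k n) (\<lambda>_. 1) x"
        using e(2) by (intro conv_mollifier_cong[OF k]) (auto simp: indicator_def subset_eq)
      then show ?case
        using True conv_mollifier_const[OF k, of n "1::real"] by (simp add: deficit_def)
    qed
  qed (use nonneg in \<open>simp add: deficit_def\<close>)
  have "(\<lambda>n. LINT x|lebesgue. deficit n x) \<longlonglongrightarrow> (LINT x::'a|lebesgue. 0)"
  proof (rule integral_dominated_convergence[OF _ _ int])
    show "AE x in lebesgue. norm (deficit n x) \<le> ?I x" for n
      using nonneg by (intro AE_I2) (auto simp: deficit_def indicator_def)
    show "AE x in lebesgue. (\<lambda>n. deficit n x) \<longlonglongrightarrow> 0"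
      using deficit_vanishes by (intro AE_I2 tendsto_eventually)
    show "deficit n \<in> borel_measurable lebesgue" for n
      using int_conv(1)[of n] int by (auto simp: deficit_def[abs_def])
  qed simp
  then show ?thesis
    unfolding L1_eq by (auto intro: tendsto_mult_right_zero)
qed

lemma conv_L1_tendsto_closed:
  fixes f :: "'a::euclidean_space \<Rightarrow> 'b::euclidean_space" and k :: "nat \<Rightarrow> 'a \<Rightarrow> real"
  assumes k: "\<And>n. mollifier (r n) (k n)" and f: "integrable lebesgue f"
    and approx: "\<And>e. 0 < e \<Longrightarrow> \<exists>g. integrable lebesgue g \<and>
      (\<lambda>n. LINT x|lebesgue. norm (conv (k n) g x - g x)) \<longlonglongrightarrow> 0 \<and> (LINT x|lebesgue. norm (f x - g x)) < e"
  shows "(\<lambda>n. LINT x|lebesgue. norm (conv (k n) f x - f x)) \<longlonglongrightarrow> 0"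
proof (rule LIMSEQ_I)
  fix e :: real assume e: "0 < e"
  then obtain g where g: "integrable lebesgue g" "(LINT x|lebesgue. norm (f x - g x)) < e / 4"
    "(\<lambda>n. LINT x|lebesgue. norm (conv (k n) g x - g x)) \<longlonglongrightarrow> 0"
    using approx[of "e / 4"] by auto
  from g(3) e obtain N where N: "\<And>n. n \<ge> N \<Longrightarrow> (LINT x|lebesgue. norm (conv (k n) g x - g x)) < e / 2"
    using order_tendstoD(2)[of _ 0 sequentially "e / 2"] unfolding eventually_sequentially by force
  have diff: "integrable lebesgue (\<lambda>x. f x - g x)"
    using f g(1) by simp
  have "(LINT x|lebesgue. norm (conv (k n) f x - f x)) < e" if "n \<ge> N" for n
  proof -
    have "(LINT x|lebesgue. norm (conv (k n) f x - f x))
        \<le> (LINT x|lebesgue. norm (conv (k n) (\<lambda>x. f x - g x) x - (f x - g x)))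
          + (LINT x|lebesgue. norm (conv (k n) g x - g x))"
      using integral_norm_conv_diff_add_le[OF k diff g(1), of n] by simp
    also have "\<dots> < e"
      using integral_norm_conv_diff_le[OF k diff, of n] g(2) N[OF that] by simp
    finally show ?thesis .
  qed
  then show "\<exists>N. \<forall>n\<ge>N. norm ((LINT x|lebesgue. norm (conv (k n) f x - f x)) - 0) < e"
    by auto
qed

lemma conv_L1_tendsto:
  fixes f :: "'a::euclidean_space \<Rightarrow> 'b::euclidean_space" and k :: "nat \<Rightarrow> 'a \<Rightarrow> real"
  assumes k: "\<And>n. mollifier (r n) (k n)" and r: "r \<longlonglongrightarrow> 0" and f: "integrable lebesgue f"
  shows "(\<lambda>n. LINT x|lebesgue. norm (conv (k n) f x - f x)) \<longlonglongrightarrow> 0"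
  using f
proof (induction rule: integrable_lebesgue_induct)
  case (indicator U c)
  then have "indicat_real U \<in> L_loc 1"
    by (intro integrable_imp_L_loc_1 integrable_real_indicator) (auto simp: fmeasurable_def)
  then have "conv (k n) (\<lambda>x. indicat_real U x *\<^sub>R c) x = conv (k n) (indicat_real U) x *\<^sub>R c" for n x
    by (rule conv_bounded_linear[OF bounded_linear_scaleR_left mollifier_C_c[OF k]])
  then have "norm (conv (k n) (\<lambda>x. indicat_real U x *\<^sub>R c) x - indicat_real U x *\<^sub>R c)
      = norm c * \<bar>conv (k n) (indicat_real U) x - indicat_real U x\<bar>" for n x
    by (simp add: scaleR_diff_left[symmetric])
  then show ?case
    using tendsto_mult_right_zero[OF conv_indicator_open_tendsto[OF k r indicator], of "norm c"] by simp
next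
  case (add f g)
  show ?case
  proof (rule tendsto_sandwich[OF _ _ tendsto_const])
    show "(\<lambda>n. (LINT x|lebesgue. norm (conv (k n) f x - f x)) + (LINT x|lebesgue. norm (conv (k n) g x - g x)))
        \<longlonglongrightarrow> 0"
      using tendsto_add[OF add.IH] by simp
  qed (simp_all add: integral_norm_conv_diff_add_le[OF k add.hyps])
next
  case (approx f)
  then show ?case
    by (rule conv_L1_tendsto_closed[OF k])
qed

lemma conv_L1_loc_tendsto:
  fixes f :: "'a::euclidean_space \<Rightarrow> 'b::euclidean_space" and k :: "nat \<Rightarrow> 'a \<Rightarrow> real"
  assumes k: "\<And>n. mollifier (r n) (k n)" and r: "r \<longlonglongrightarrow> 0" and f: "f \<in> L_loc 1"
  shows "(\<lambda>n. LINT x:cball 0 R|lebesgue. norm (conv (k n) f x - f x)) \<longlonglongrightarrow> 0"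
proof -
  define g where "g x = indicat_real (cball 0 (R + 1)) x *\<^sub>R f x" for x
  have g: "integrable lebesgue g"
    unfolding g_def[abs_def] by (rule L_loc_1_integrable_cball[OF f])
  have "\<forall>\<^sub>F n in sequentially. r n < 1"
    using order_tendstoD(2)[OF r, of 1] by simp
  then have restricted_le: "\<forall>\<^sub>F n in sequentially. (LINT x:cball 0 R|lebesgue. norm (conv (k n) f x - f x))
      \<le> (LINT x|lebesgue. norm (conv (k n) g x - g x))"
  proof eventually_elim
    case (elim n)
    have "f y = g y" if "x \<in> cball 0 R" "dist x y < r n \<or> y = x" for x y
      using that elim norm_triangle_ineq2[of y x] by (auto simp: g_def dist_norm norm_minus_commute)
    then have "(LINT x:cball 0 R|lebesgue. norm (conv (k n) f x - f x))
        = (LINT x:cball 0 R|lebesgue. norm (conv (k n) g x - g x))"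
      by (intro set_lebesgue_integral_cong allI impI arg_cong[of _ _ norm] arg_cong2[of _ _ _ _ minus]
          conv_mollifier_cong[OF k]) auto
    also have "\<dots> \<le> (LINT x|lebesgue. norm (conv (k n) g x - g x))"
      unfolding set_lebesgue_integral_def using integrable_conv(1)[OF k g, of n] g
      by (intro integral_mono integrable_mult_indicator integrable_norm) (auto simp: indicator_def)
    finally show ?case .
  qed
  show ?thesis
  proof (rule tendsto_sandwich[OF _ restricted_le tendsto_const conv_L1_tendsto[OF k r g]])
    show "\<forall>\<^sub>F n in sequentially. 0 \<le> (LINT x:cball 0 R|lebesgue. norm (conv (k n) f x - f x))"
      unfolding set_lebesgue_integral_def
      by (intro always_eventually allI Bochner_Integration.integral_nonneg) simp
  qed
qed

lemma continuous_imp_L_loc_1: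
  fixes f :: "'a::euclidean_space \<Rightarrow> 'b::euclidean_space"
  assumes f: "continuous_on UNIV f"
  shows "f \<in> L_loc 1"
proof -
  have [measurable]: "f \<in> borel_measurable borel"
    using f by (rule borel_measurable_continuous_onI)
  have "integrable lebesgue (\<lambda>x. indicat_real K x *\<^sub>R f x)" if "compact K" for K
  proof -
    have [measurable]: "K \<in> sets borel"
      using that by (simp add: compact_imp_closed)
    have "integrable lborel (\<lambda>x. indicat_real K x *\<^sub>R f x)"
      using that f by (intro borel_integrable_compact) (auto intro: continuous_on_subset)
    then show ?thesis
      by (subst integrable_completion) auto
  qed
  then show ?thesis
    by (auto simp: L_loc_1_iff set_integrable_def intro: measurable_completion)
qed

lemma L_loc_1_conv:
  fixes f :: "'a::euclidean_space \<Rightarrow> 'b::euclidean_space"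
  shows "k \<in> C_c \<Longrightarrow> f \<in> L_loc 1 \<Longrightarrow> conv k f \<in> L_loc 1"
  by (rule continuous_imp_L_loc_1[OF continuous_conv])

lemma mollifiers_AE_tendsto:
  fixes f :: "'a::euclidean_space \<Rightarrow> 'b::euclidean_space"
  assumes f: "f \<in> L_loc 1"
  obtains r and k :: "nat \<Rightarrow> 'a \<Rightarrow> real" where "\<And>n. mollifier (r n) (k n)" "r \<longlonglongrightarrow> 0"
    "AE x in lebesgue. x \<in> cball 0 R \<longrightarrow> (\<lambda>n. conv (k n) f x) \<longlonglongrightarrow> f x"
proof -
  define r where "r n = inverse (real (Suc n))" for n
  have r: "r \<longlonglongrightarrow> 0"
    unfolding r_def by (rule LIMSEQ_inverse_real_of_nat)
  have "\<exists>k :: 'a \<Rightarrow> real. mollifier (r n) k" for n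
    using mollifier_exists[of "r n"] by (auto simp: r_def)
  then obtain k :: "nat \<Rightarrow> 'a \<Rightarrow> real" where k: "\<And>n. mollifier (r n) (k n)"
    by metis
  define u where "u n x = indicat_real (cball 0 R) x *\<^sub>R (conv (k n) f x - f x)" for n x
  have "integrable lebesgue (u n)" for n
  proof -
    have "(\<lambda>x. conv (k n) f x - f x) \<in> L_loc 1"
      by (intro L_loc_diff L_loc_1_conv mollifier_C_c[OF k] f) simp
    then show ?thesis
      unfolding u_def[abs_def] by (rule L_loc_1_integrable_cball)
  qed
  moreover have "(\<lambda>n. LINT x|lebesgue. norm (u n x)) \<longlonglongrightarrow> 0"
    using conv_L1_loc_tendsto[OF k r f, of R] by (simp add: u_def set_lebesgue_integral_def)
  ultimately obtain s where s: "strict_mono s" "AE x in lebesgue. (\<lambda>n. u (s n) x) \<longlonglongrightarrow> 0"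
    using tendsto_L1_AE_subseq by blast
  show thesis
  proof
    show "mollifier ((r \<circ> s) n) ((k \<circ> s) n)" for n
      using k by simp
    show "(r \<circ> s) \<longlonglongrightarrow> 0"
      by (rule LIMSEQ_subseq_LIMSEQ[OF r s(1)])
    show "AE x in lebesgue. x \<in> cball 0 R \<longrightarrow> (\<lambda>n. conv ((k \<circ> s) n) f x) \<longlonglongrightarrow> f x"
      using s(2) by eventually_elim (auto simp: u_def intro: LIM_zero_cancel)
  qed
qed

subsection \<open>Testing a weak inequality with a function of a Sobolev function\<close>

lemma dominated_convergence_moving_bounds:
  fixes f g :: "nat \<Rightarrow> 'a \<Rightarrow> real"
  assumes [measurable]: "\<And>n. f n \<in> borel_measurable M" "F \<in> borel_measurable M"
    and g: "\<And>n. integrable M (g n)" and G: "integrable M G"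
    and f_tendsto: "AE x in M. (\<lambda>n. f n x) \<longlonglongrightarrow> F x"
    and f_le: "\<And>n. AE x in M. \<bar>f n x\<bar> \<le> g n x" and F_le: "AE x in M. \<bar>F x\<bar> \<le> G x"
    and g_tendsto: "(\<lambda>n. \<integral>x. \<bar>g n x - G x\<bar> \<partial>M) \<longlonglongrightarrow> 0"
  shows "(\<lambda>n. \<integral>x. f n x \<partial>M) \<longlonglongrightarrow> (\<integral>x. F x \<partial>M)"
proof -
  have [measurable]: "G \<in> borel_measurable M" using G by auto
  define t where "t n x = max (- G x) (min (G x) (f n x))" for n x
  have [measurable]: "t n \<in> borel_measurable M" for n
    unfolding t_def by measurable
  have G_nonneg: "AE x in M. 0 \<le> G x"
    using F_le by eventually_elim auto
  have t_le: "AE x in M. norm (t n x) \<le> G x" for n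
    using G_nonneg by eventually_elim (auto simp: t_def)
  have f_int: "integrable M (f n)" for n
    by (rule Bochner_Integration.integrable_bound[OF g[of n]]) (use f_le[of n] in \<open>auto elim!: eventually_mono\<close>)
  have t_int: "integrable M (t n)" for n
    by (rule Bochner_Integration.integrable_bound[OF G]) (use t_le[of n] in \<open>auto elim!: eventually_mono\<close>)
  have "(\<lambda>n. \<integral>x. t n x \<partial>M) \<longlonglongrightarrow> (\<integral>x. F x \<partial>M)"
  proof (rule integral_dominated_convergence[OF _ _ G _ t_le])
    show "AE x in M. (\<lambda>n. t n x) \<longlonglongrightarrow> F x"
      using f_tendsto F_le
    proof eventually_elim
      case (elim x)
      then have "max (- G x) (min (G x) (F x)) = F x"
        by auto
      moreover have "(\<lambda>n. t n x) \<longlonglongrightarrow> max (- G x) (min (G x) (F x))"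
        unfolding t_def by (intro tendsto_intros elim)
      ultimately show ?case by simp
    qed
  qed auto
  moreover have "(\<lambda>n. (\<integral>x. f n x \<partial>M) - (\<integral>x. t n x \<partial>M)) \<longlonglongrightarrow> 0"
  proof (rule Lim_null_comparison[OF _ g_tendsto], intro always_eventually allI)
    fix n
    have "norm ((\<integral>x. f n x \<partial>M) - (\<integral>x. t n x \<partial>M)) \<le> (\<integral>x. norm (f n x - t n x) \<partial>M)"
      using integral_norm_bound[of M "\<lambda>x. f n x - t n x"] t_int f_int by simp
    also have "\<dots> \<le> (\<integral>x. \<bar>g n x - G x\<bar> \<partial>M)"
    proof (rule integral_mono_AE)
      show "AE x in M. norm (f n x - t n x) \<le> \<bar>g n x - G x\<bar>"
        using f_le[of n] G_nonneg
        by eventually_elim (auto simp: t_def max_def min_def abs_if split: if_splits)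
    qed (use t_int f_int g G in auto)
    finally show "norm ((\<integral>x. f n x \<partial>M) - (\<integral>x. t n x \<partial>M)) \<le> (\<integral>x. \<bar>g n x - G x\<bar> \<partial>M)" .
  qed
  ultimately show ?thesis
    using tendsto_add by fastforce
qed

lemma mollifiers_AE_tendsto_pair:
  fixes f :: "'a::euclidean_space \<Rightarrow> 'b::euclidean_space" and g :: "'a \<Rightarrow> 'c::euclidean_space"
  assumes f: "f \<in> L_loc 1" and g: "g \<in> L_loc 1"
  obtains r and k :: "nat \<Rightarrow> 'a \<Rightarrow> real" where "\<And>n. mollifier (r n) (k n)" "r \<longlonglongrightarrow> 0"
    "AE x in lebesgue. x \<in> cball 0 R \<longrightarrow>
      (\<lambda>n. conv (k n) f x) \<longlonglongrightarrow> f x \<and> (\<lambda>n. conv (k n) g x) \<longlonglongrightarrow> g x"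
proof -
  have pair: "(\<lambda>x. (f x, g x)) \<in> L_loc 1"
  proof (rule L_loc_dominated[OF L_loc_1_add[OF f[THEN L_loc_norm_powr] g[THEN L_loc_norm_powr]]])
    show "norm (f x, g x) powr 1 \<le> norm (f x) powr 1 + norm (g x) powr 1" for x
      using norm_Pair_le[of "f x" "g x"] by simp
  qed (use f g in measurable)
  show thesis
  proof (rule mollifiers_AE_tendsto[OF pair, of R])
    fix r and k :: "nat \<Rightarrow> 'a \<Rightarrow> real"
    assume k: "\<And>n. mollifier (r n) (k n)" "r \<longlonglongrightarrow> 0"
    have "conv (k n) f x = fst (conv (k n) (\<lambda>x. (f x, g x)) x)"
      "conv (k n) g x = snd (conv (k n) (\<lambda>x. (f x, g x)) x)" for n x
      using conv_bounded_linear[OF bounded_linear_fst mollifier_C_c[OF k(1)] pair, of n x]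
        conv_bounded_linear[OF bounded_linear_snd mollifier_C_c[OF k(1)] pair, of n x] by simp_all
    moreover assume "AE x in lebesgue. x \<in> cball 0 R \<longrightarrow> (\<lambda>n. conv (k n) (\<lambda>x. (f x, g x)) x) \<longlonglongrightarrow> (f x, g x)"
    ultimately have "AE x in lebesgue. x \<in> cball 0 R \<longrightarrow>
        (\<lambda>n. conv (k n) f x) \<longlonglongrightarrow> f x \<and> (\<lambda>n. conv (k n) g x) \<longlonglongrightarrow> g x"
      by (auto elim!: eventually_mono dest: tendsto_fst tendsto_snd)
    with k show thesis by (rule that)
  qed
qed

definition weak_divergence_ge :: "('a::euclidean_space \<Rightarrow> 'a) \<Rightarrow> ('a \<Rightarrow> real) \<Rightarrow> bool" where
  "weak_divergence_ge F G \<longleftrightarrow>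
     (\<forall>\<phi>\<in>C1_0. (\<forall>x. 0 \<le> \<phi> x) \<longrightarrow> (LINT x|lebesgue. F x \<bullet> grad \<phi> x + G x * \<phi> x) \<le> 0)"

locale composition_test =
  fixes p L :: real and w :: "'a::euclidean_space \<Rightarrow> real" and W F :: "'a \<Rightarrow> 'a" and G \<eta> :: "'a \<Rightarrow> real"
    and \<psi> \<psi>' :: "real \<Rightarrow> real"
  assumes p: "1 < p"
    and weak_gradient: "has_weak_gradient w W"
    and W_L_loc: "W \<in> L_loc p" and F_L_loc: "F \<in> L_loc (p / (p - 1))" and G_L_loc: "G \<in> L_loc 1"
    and divergence: "weak_divergence_ge F G"
    and \<psi>_deriv: "(\<psi> has_real_derivative \<psi>' t) (at t)" and \<psi>'_continuous: "continuous_on UNIV \<psi>'"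
    and \<psi>_nonneg: "0 \<le> \<psi> t" and \<psi>_le: "\<psi> t \<le> 1" and \<psi>'_le: "\<bar>\<psi>' t\<bar> \<le> L"
    and \<eta>: "\<eta> \<in> C1_0" and \<eta>_nonneg: "0 \<le> \<eta> x"
begin

definition integrand :: "real \<Rightarrow> 'a \<Rightarrow> 'a \<Rightarrow> real" where
  "integrand v V x = F x \<bullet> (\<psi> v *\<^sub>R grad \<eta> x + (\<eta> x * \<psi>' v) *\<^sub>R V) + G x * (\<psi> v * \<eta> x)"

lemma w_L_loc: "w \<in> L_loc 1" and W_L_loc_1: "W \<in> L_loc 1"
  using weak_gradient by (auto simp: has_weak_gradient_def)

lemma L_nonneg: "0 \<le> L"
  using order_trans[OF abs_ge_zero \<psi>'_le] .

lemma \<psi>_continuous: "continuous_on S \<psi>"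
  by (intro continuous_at_imp_continuous_on ballI DERIV_isCont[OF \<psi>_deriv])

lemma integrand_measurable:
  assumes [measurable]: "v \<in> borel_measurable lebesgue" "V \<in> borel_measurable lebesgue"
  shows "(\<lambda>x. integrand (v x) (V x) x) \<in> borel_measurable lebesgue"
proof -
  have [measurable]: "\<psi> \<in> borel_measurable borel" "\<psi>' \<in> borel_measurable borel"
    by (intro borel_measurable_continuous_onI \<psi>_continuous \<psi>'_continuous)+
  note [measurable] = L_loc_measurable[OF F_L_loc] L_loc_measurable[OF G_L_loc]
    C_c_measurable(2)[OF C1_0_C_c[OF \<eta>]] C_c_measurable(2)[OF C1_0_grad_C_c[OF \<eta>]]
  show ?thesis
    unfolding integrand_def by measurable
qed

lemma norm_flux_mult_le:
  assumes "0 \<le> b"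
  shows "norm (F x) * b \<le> norm (F x) powr (p / (p - 1)) + b powr p"
proof -
  have "norm (F x) * b \<le> norm (F x) powr (p / (p - 1)) / (p / (p - 1)) + b powr p / p"
    using p assms by (intro Youngs_inequality) (auto simp: field_simps)
  also have "\<dots> \<le> norm (F x) powr (p / (p - 1)) + b powr p"
  proof (rule add_mono)
    have "a / s \<le> a" if "0 \<le> a" "1 \<le> s" for a s :: real
      using that mult_left_mono[of 1 s a] by (simp add: divide_le_eq)
    then show "norm (F x) powr (p / (p - 1)) / (p / (p - 1)) \<le> norm (F x) powr (p / (p - 1))"
      "b powr p / p \<le> b powr p"
      using p by (auto simp: le_divide_eq simp del: divide_divide_eq_right)
  qed
  finally show ?thesis .
qed

lemma abs_integrand_le:
  assumes B: "0 \<le> B" "\<eta> x \<le> B" "norm (grad \<eta> x) \<le> B"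
  shows "\<bar>integrand v V x\<bar>
    \<le> B * ((1 + L) * norm (F x) powr (p / (p - 1)) + 1 + norm (G x)) + B * L * norm V powr p"
proof -
  have "\<bar>\<psi> v\<bar> * norm (grad \<eta> x) \<le> 1 * B"
    using \<psi>_nonneg \<psi>_le B by (intro mult_mono) auto
  then have "\<bar>F x \<bullet> (\<psi> v *\<^sub>R grad \<eta> x)\<bar> \<le> norm (F x) * B"
    by (intro order_trans[OF Cauchy_Schwarz_ineq2] mult_left_mono) auto
  moreover have "\<bar>\<eta> x * \<psi>' v\<bar> * norm V \<le> B * L * norm V"
    using \<psi>'_le B \<eta>_nonneg unfolding abs_mult by (intro mult_right_mono mult_mono) auto
  then have "\<bar>F x \<bullet> ((\<eta> x * \<psi>' v) *\<^sub>R V)\<bar> \<le> norm (F x) * (B * L * norm V)"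
    by (intro order_trans[OF Cauchy_Schwarz_ineq2] mult_left_mono) auto
  moreover have "\<bar>G x * (\<psi> v * \<eta> x)\<bar> \<le> \<bar>G x\<bar> * (1 * B)"
    using \<psi>_nonneg \<psi>_le \<eta>_nonneg B unfolding abs_mult
    by (intro mult_left_mono mult_mono) auto
  ultimately have "\<bar>integrand v V x\<bar> \<le> B * (norm (F x) * 1) + B * L * (norm (F x) * norm V) + B * \<bar>G x\<bar>"
    unfolding integrand_def inner_add_right by (simp add: mult_ac)
  also have "\<dots> \<le> B * (norm (F x) powr (p / (p - 1)) + 1 powr p)
      + B * L * (norm (F x) powr (p / (p - 1)) + norm V powr p) + B * \<bar>G x\<bar>"
    using B(1) L_nonneg by (intro add_mono mult_left_mono norm_flux_mult_le) auto
  finally show ?thesis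
    by (simp add: algebra_simps)
qed

lemma integrand_bound:
  obtains Q C R where "integrable lebesgue Q" "0 \<le> C"
    "\<And>v V x. \<bar>integrand v V x\<bar> \<le> Q x + C * (indicator (cball 0 R) x * norm V powr p)"
    "\<And>v V x. x \<notin> cball 0 R \<Longrightarrow> integrand v V x = 0"
proof -
  obtain R1 B1 where \<eta>_bound:
    "0 < B1" "\<And>x. norm (\<eta> x) \<le> B1 * indicator (cball 0 R1) x" "\<And>x. norm (\<eta> x) \<le> B1"
    using C_c_bound[OF C1_0_C_c[OF \<eta>]] by metis
  obtain R2 B2 where grad_bound:
    "\<And>x. norm (grad \<eta> x) \<le> B2 * indicator (cball 0 R2) x" "\<And>x. norm (grad \<eta> x) \<le> B2"
    using C_c_bound[OF C1_0_grad_C_c[OF \<eta>]] by metis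
  define R B where "R = max R1 R2" and "B = max B1 B2"
  have B: "0 < B" "\<eta> x \<le> B" "norm (grad \<eta> x) \<le> B" for x
    using \<eta>_bound(1) \<eta>_bound(3)[of x] grad_bound(2)[of x] by (auto simp: B_def)
  have outside: "integrand v V x = 0" if "x \<notin> cball 0 R" for v V x
    using that \<eta>_bound(2)[of x] grad_bound(1)[of x] by (simp add: R_def integrand_def)
  define Q where "Q x = B *\<^sub>R ((1 + L) *\<^sub>R norm (F x) powr (p / (p - 1)) + 1 + norm (G x) powr 1)" for x
  have "Q \<in> L_loc 1"
    unfolding Q_def by (intro L_loc_1_add L_loc_1_scaleR L_loc_const L_loc_norm_powr F_L_loc G_L_loc)
  then have "integrable lebesgue (\<lambda>x. indicat_real (cball 0 R) x *\<^sub>R Q x)"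
    by (rule L_loc_1_integrable_cball)
  moreover have "\<bar>integrand v V x\<bar>
      \<le> indicat_real (cball 0 R) x *\<^sub>R Q x + B * L * (indicat_real (cball 0 R) x * norm V powr p)" for v V x
    using abs_integrand_le[of B x v V] B less_imp_le[OF B(1)] outside[of x v V]
    by (cases "x \<in> cball 0 R") (simp_all add: Q_def)
  ultimately show thesis
    using B(1) L_nonneg outside by (intro that[of _ "B * L" R]) auto
qed

lemma integral_integrand_conv_le:
  assumes k: "k \<in> C1_0"
  shows "(LINT x|lebesgue. integrand (conv k w x) (conv k W x) x) \<le> 0"
proof -
  note continuous = continuous_conv[OF C1_0_C_c[OF k] w_L_loc] continuous_conv[OF C1_0_C_c[OF k] W_L_loc_1]
  have deriv: "GDERIV (\<lambda>x. \<psi> (conv k w x)) x :> \<psi>' (conv k w x) *\<^sub>R conv k W x" for x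
    by (intro GDERIV_DERIV_compose GDERIV_conv_weak_gradient[OF weak_gradient k] \<psi>_deriv)
  have "continuous_on UNIV (\<lambda>x. \<psi>' (conv k w x) *\<^sub>R conv k W x)"
    by (intro continuous_intros continuous continuous_on_compose2[OF \<psi>'_continuous]) auto
  note test = C1_0_mult[OF deriv this \<eta>]
  have "(LINT x|lebesgue. F x \<bullet> grad (\<lambda>x. \<psi> (conv k w x) * \<eta> x) x + G x * (\<psi> (conv k w x) * \<eta> x)) \<le> 0"
    using divergence test(1) \<psi>_nonneg \<eta>_nonneg by (simp add: weak_divergence_ge_def)
  then show ?thesis
    unfolding test(2) by (simp add: integrand_def)
qed

lemma integral_integrand_conv_tendsto:
  assumes k: "\<And>n. mollifier (r n) (k n)" "r \<longlonglongrightarrow> 0"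
    and bound: "integrable lebesgue Q" "0 \<le> C"
      "\<And>v V x. \<bar>integrand v V x\<bar> \<le> Q x + C * (indicator (cball 0 R) x * norm V powr p)"
    and tendsto: "AE x in lebesgue.
      (\<lambda>n. integrand (conv (k n) w x) (conv (k n) W x) x) \<longlonglongrightarrow> integrand (w x) (W x) x"
  shows "(\<lambda>n. LINT x|lebesgue. integrand (conv (k n) w x) (conv (k n) W x) x)
    \<longlonglongrightarrow> (LINT x|lebesgue. integrand (w x) (W x) x)"
proof -
  let ?dom = "\<lambda>g x. Q x + C * (indicat_real (cball 0 R) x * g x)"
  let ?Wp = "\<lambda>x. norm (W x) powr p"
  have Wp: "?Wp \<in> L_loc 1"
    by (rule L_loc_norm_powr[OF W_L_loc])
  have dom: "integrable lebesgue (?dom g)" if "g \<in> L_loc 1" for g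
    using L_loc_1_integrable_cball[OF that, of 0 R] bound(1) by simp
  note conv_L_loc_1 = L_loc_1_conv[OF mollifier_C_c[OF k(1)]]
  show ?thesis
  proof (rule dominated_convergence_moving_bounds[OF _ _ dom[OF conv_L_loc_1[OF Wp]] dom[OF Wp] tendsto])
    show "AE x in lebesgue. \<bar>integrand (conv (k n) w x) (conv (k n) W x) x\<bar> \<le> ?dom (conv (k n) ?Wp) x" for n
    proof (rule AE_I2)
      fix x
      have "C * (indicat_real (cball 0 R) x * norm (conv (k n) W x) powr p)
          \<le> C * (indicat_real (cball 0 R) x * conv (k n) ?Wp x)"
        using norm_conv_powr_le[OF k(1) W_L_loc] p bound(2) by (intro mult_left_mono) auto
      then show "\<bar>integrand (conv (k n) w x) (conv (k n) W x) x\<bar> \<le> ?dom (conv (k n) ?Wp) x"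
        using bound(3)[of "conv (k n) w x" "conv (k n) W x" x] by linarith
    qed
    show "AE x in lebesgue. \<bar>integrand (w x) (W x) x\<bar> \<le> ?dom ?Wp x"
      using bound(3) by simp
    have "\<bar>?dom (conv (k n) ?Wp) x - ?dom ?Wp x\<bar>
        = C * (indicat_real (cball 0 R) x *\<^sub>R norm (conv (k n) ?Wp x - ?Wp x))" for n x
      using bound(2) by (simp add: abs_mult flip: right_diff_distrib)
    then show "(\<lambda>n. LINT x|lebesgue. \<bar>?dom (conv (k n) ?Wp) x - ?dom ?Wp x\<bar>) \<longlonglongrightarrow> 0"
      using tendsto_mult_right_zero[OF conv_L1_loc_tendsto[OF k Wp, of R], of C]
      by (simp add: set_lebesgue_integral_def)
    show "(\<lambda>x. integrand (conv (k n) w x) (conv (k n) W x) x) \<in> borel_measurable lebesgue" for n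
      by (intro integrand_measurable L_loc_measurable[OF conv_L_loc_1] w_L_loc W_L_loc_1)
    show "(\<lambda>x. integrand (w x) (W x) x) \<in> borel_measurable lebesgue"
      by (rule integrand_measurable[OF w_L_loc[THEN L_loc_measurable] W_L_loc_1[THEN L_loc_measurable]])
  qed
qed

lemma integrable_integrand: "integrable lebesgue (\<lambda>x. integrand (w x) (W x) x)"
proof -
  obtain Q C R where bound: "integrable lebesgue Q"
    "\<And>v V x. \<bar>integrand v V x\<bar> \<le> Q x + C * (indicator (cball 0 R) x * norm V powr p)"
    using integrand_bound by metis
  show ?thesis
  proof (rule Bochner_Integration.integrable_bound)
    show "integrable lebesgue (\<lambda>x. Q x + C * (indicat_real (cball 0 R) x * norm (W x) powr p))"
      using L_loc_1_integrable_cball[OF L_loc_norm_powr[OF W_L_loc], of 0 R] bound(1) by simp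
    show "AE x in lebesgue. norm (integrand (w x) (W x) x)
        \<le> norm (Q x + C * (indicat_real (cball 0 R) x * norm (W x) powr p))"
      using bound(2) by (auto intro!: AE_I2 order_trans[OF _ abs_ge_self])
  qed (rule integrand_measurable[OF w_L_loc[THEN L_loc_measurable] W_L_loc[THEN L_loc_measurable]])
qed

lemma integral_integrand_le: "(LINT x|lebesgue. integrand (w x) (W x) x) \<le> 0"
proof -
  obtain Q C R where bound: "integrable lebesgue Q" "0 \<le> C"
    "\<And>v V x. \<bar>integrand v V x\<bar> \<le> Q x + C * (indicator (cball 0 R) x * norm V powr p)"
    and outside: "\<And>v V x. x \<notin> cball 0 R \<Longrightarrow> integrand v V x = 0"
    using integrand_bound by metis
  show ?thesis
  proof (rule mollifiers_AE_tendsto_pair[OF w_L_loc W_L_loc_1, of R])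
    fix r and k :: "nat \<Rightarrow> 'a \<Rightarrow> real"
    assume k: "\<And>n. mollifier (r n) (k n)" "r \<longlonglongrightarrow> 0"
    assume "AE x in lebesgue. x \<in> cball 0 R \<longrightarrow>
      (\<lambda>n. conv (k n) w x) \<longlonglongrightarrow> w x \<and> (\<lambda>n. conv (k n) W x) \<longlonglongrightarrow> W x"
    then have "AE x in lebesgue. (\<lambda>n. integrand (conv (k n) w x) (conv (k n) W x) x) \<longlonglongrightarrow> integrand (w x) (W x) x"
    proof eventually_elim
      case (elim x)
      show ?case
      proof (cases "x \<in> cball 0 R")
        case True
        have "isCont \<psi> (w x)" "isCont \<psi>' (w x)"
          using \<psi>_continuous[of UNIV] \<psi>'_continuous by (auto simp: continuous_on_eq_continuous_at)
        with elim True show ?thesis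
          unfolding integrand_def
          by (intro tendsto_intros isCont_tendsto_compose[of _ \<psi>] isCont_tendsto_compose[of _ \<psi>']) auto
      qed (simp add: outside)
    qed
    then have "(\<lambda>n. LINT x|lebesgue. integrand (conv (k n) w x) (conv (k n) W x) x)
        \<longlonglongrightarrow> (LINT x|lebesgue. integrand (w x) (W x) x)"
      by (rule integral_integrand_conv_tendsto[OF k bound])
    then show ?thesis
      using integral_integrand_conv_le k(1) by (intro LIMSEQ_le_const2) (auto simp: mollifier_def)
  qed
qed

end

subsection \<open>Signed powers\<close>

definition signed_powr :: "real \<Rightarrow> 'a::real_normed_vector \<Rightarrow> 'a" where
  "signed_powr r x = norm x powr (r - 1) *\<^sub>R x"

lemma signed_powr_real: "signed_powr r x = \<bar>x\<bar> powr (r - 1) * x" for x :: real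
  by (simp add: signed_powr_def)

lemma norm_signed_powr: "norm (signed_powr r x) = norm x powr r"
  using powr_mult_base[of "norm x" "r - 1"] by (simp add: signed_powr_def mult.commute)

lemma signed_powr_signed_powr: "signed_powr r (signed_powr s x) = signed_powr (r * s) x"
proof (cases "x = 0")
  case False
  have "signed_powr r (signed_powr s x) = norm x powr (s * (r - 1) + (s - 1)) *\<^sub>R x"
    unfolding signed_powr_def[of r] norm_signed_powr powr_powr
    by (simp add: signed_powr_def powr_add)
  then show ?thesis
    by (simp add: signed_powr_def algebra_simps)
qed (simp add: signed_powr_def)

lemma signed_powr_surj:
  assumes "0 < r"
  obtains y where "signed_powr r y = x"
proof
  show "signed_powr r (signed_powr (1 / r) x) = x"
    using assms unfolding signed_powr_signed_powr by (simp add: signed_powr_def)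
qed

lemma L_loc_signed_powr:
  fixes f :: "'a::euclidean_space \<Rightarrow> 'b::euclidean_space"
  assumes "f \<in> L_loc (r * s)"
  shows "(\<lambda>x. signed_powr r (f x)) \<in> L_loc s"
proof (rule L_loc_dominated[OF L_loc_norm_powr[OF assms]])
  note [measurable] = L_loc_measurable[OF assms]
  show "(\<lambda>x. signed_powr r (f x)) \<in> borel_measurable lebesgue"
    unfolding signed_powr_def by measurable
qed (simp add: norm_signed_powr powr_powr)

lemma L_loc_signed_powr_conjugate:
  fixes U :: "'a::euclidean_space \<Rightarrow> 'a"
  assumes "1 < p" "U \<in> L_loc p"
  shows "(\<lambda>x. signed_powr (p - 1) (U x)) \<in> L_loc (p / (p - 1))"
  using assms by (intro L_loc_signed_powr) simp

lemma signed_powr_diff_inner_ge: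
  fixes x y :: "'a::real_inner"
  assumes r: "1 \<le> r"
  shows "max (norm x) (norm y) powr (r - 1) / 2 * (norm (x - y))\<^sup>2
    \<le> (signed_powr r x - signed_powr r y) \<bullet> (x - y)"
proof -
  define a b where "a = norm x powr (r - 1)" and "b = norm y powr (r - 1)"
  have "0 \<le> (a - b) * ((norm x)\<^sup>2 - (norm y)\<^sup>2)"
  proof (cases "norm y \<le> norm x")
    case True
    then have "b \<le> a" "(norm y)\<^sup>2 \<le> (norm x)\<^sup>2"
      using r by (auto simp: a_def b_def intro: powr_mono2 power_mono)
    then show ?thesis by simp
  next
    case False
    then have "a \<le> b" "(norm x)\<^sup>2 \<le> (norm y)\<^sup>2"
      using r by (auto simp: a_def b_def intro: powr_mono2 power_mono)
    then show ?thesis by (simp add: mult_nonpos_nonpos)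
  qed
  moreover have "max (norm x) (norm y) powr (r - 1) * (norm (x - y))\<^sup>2 \<le> (a + b) * (norm (x - y))\<^sup>2"
    by (intro mult_right_mono) (auto simp: a_def b_def max_def)
  moreover have "2 * ((signed_powr r x - signed_powr r y) \<bullet> (x - y))
      = (a + b) * (norm (x - y))\<^sup>2 + (a - b) * ((norm x)\<^sup>2 - (norm y)\<^sup>2)"
    unfolding signed_powr_def a_def[symmetric] b_def[symmetric] power2_norm_eq_inner
    by (simp add: inner_diff inner_commute[of y x] algebra_simps)
  ultimately show ?thesis by simp
qed

lemma norm_signed_powr_diff_le:
  fixes x y :: "'a::real_normed_vector"
  assumes r: "1 \<le> r"
  shows "norm (signed_powr r x - signed_powr r y) \<le> (1 + r) * max (norm x) (norm y) powr (r - 1) * norm (x - y)"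
proof -
  have ordered: "norm (signed_powr r x - signed_powr r y) \<le> (1 + r) * norm x powr (r - 1) * norm (x - y)"
    if ordered_norms: "norm y \<le> norm x" for x y :: 'a
  proof -
    define a b where "a = norm x powr (r - 1)" and "b = norm y powr (r - 1)"
    have "b \<le> a"
      using ordered_norms r by (auto simp: a_def b_def intro: powr_mono2)
    have powers: "norm x powr r = norm x * a" "norm y powr r = norm y * b"
      by (simp_all add: a_def b_def powr_mult_base)
    have "(a - b) * norm y \<le> norm x powr r - norm y powr r"
      using mult_right_mono[OF ordered_norms, of a] by (simp add: powers algebra_simps a_def)
    also have "\<dots> \<le> r * a * (norm x - norm y)"
      using powr_above_tangent[of "norm y" "norm x" r] r by (simp add: a_def algebra_simps)
    also have "\<dots> \<le> r * a * norm (x - y)"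
      using r by (intro mult_left_mono norm_triangle_ineq2) (simp add: a_def)
    finally have remainder: "(a - b) * norm y \<le> r * a * norm (x - y)" .
    have "signed_powr r x - signed_powr r y = a *\<^sub>R (x - y) + (a - b) *\<^sub>R y"
      by (simp add: signed_powr_def a_def b_def algebra_simps)
    then have "norm (signed_powr r x - signed_powr r y) \<le> a * norm (x - y) + (a - b) * norm y"
      using norm_triangle_ineq[of "a *\<^sub>R (x - y)" "(a - b) *\<^sub>R y"] \<open>b \<le> a\<close> by (simp add: a_def)
    with remainder show ?thesis
      by (simp add: a_def algebra_simps)
  qed
  show ?thesis
    using ordered[of y x] ordered[of x y]
    by (cases "norm y \<le> norm x") (simp_all add: norm_minus_commute max_def)
qed

lemma norm_signed_powr_diff_square_le:
  fixes x y :: "'a::real_inner"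
  assumes r: "1 \<le> r" and b: "norm x \<le> b" "norm y \<le> b"
  shows "(norm (signed_powr r x - signed_powr r y))\<^sup>2
    \<le> 2 * (1 + r)\<^sup>2 * b powr (r - 1) * ((signed_powr r x - signed_powr r y) \<bullet> (x - y))"
proof -
  let ?M = "max (norm x) (norm y) powr (r - 1)" and ?D = "(signed_powr r x - signed_powr r y) \<bullet> (x - y)"
  have inner_ge: "?M / 2 * (norm (x - y))\<^sup>2 \<le> ?D"
    by (rule signed_powr_diff_inner_ge[OF r])
  then have "0 \<le> ?D"
    by (rule order_trans[rotated]) simp
  have "(norm (signed_powr r x - signed_powr r y))\<^sup>2 \<le> ((1 + r) * ?M * norm (x - y))\<^sup>2"
    by (intro power_mono norm_signed_powr_diff_le r) simp
  also have "\<dots> = 2 * (1 + r)\<^sup>2 * ?M * (?M / 2 * (norm (x - y))\<^sup>2)"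
    by (simp add: power2_eq_square)
  also have "\<dots> \<le> 2 * (1 + r)\<^sup>2 * ?M * ?D"
    by (intro mult_left_mono inner_ge) simp
  also have "\<dots> \<le> 2 * (1 + r)\<^sup>2 * b powr (r - 1) * ?D"
    using b r \<open>0 \<le> ?D\<close>
    by (intro mult_right_mono mult_left_mono powr_mono2) (auto simp: le_max_iff_disj)
  finally show ?thesis .
qed

lemma norm_signed_powr_diff_le_twice:
  assumes "0 \<le> r" "norm x \<le> b" "norm y \<le> b"
  shows "norm (signed_powr r x - signed_powr r y) \<le> 2 * b powr r"
proof -
  have "norm (signed_powr r x - signed_powr r y) \<le> norm x powr r + norm y powr r"
    using norm_triangle_ineq4 norm_signed_powr by metis
  also have "\<dots> \<le> b powr r + b powr r"
    using assms by (intro add_mono powr_mono2) auto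
  finally show ?thesis by simp
qed

lemma signed_powr_diff_ge:
  fixes u v :: real
  assumes r: "1 \<le> r" and "v < u"
  shows "((u - v) / 2) powr r \<le> signed_powr r u - signed_powr r v"
proof -
  let ?d = "u - v"
  have "(?d / 2) powr r * ?d = (?d / 2) powr (r - 1) / 2 * ?d\<^sup>2"
    using \<open>v < u\<close> powr_mult_base[of "?d / 2" "r - 1"] by (simp add: power2_eq_square mult.commute)
  also have "\<dots> \<le> max (norm u) (norm v) powr (r - 1) / 2 * (norm ?d)\<^sup>2"
    using r \<open>v < u\<close> by (intro mult_mono divide_right_mono powr_mono2) auto
  also have "\<dots> \<le> (signed_powr r u - signed_powr r v) * ?d"
    using signed_powr_diff_inner_ge[OF r, of u v] by simp
  finally show ?thesis
    using \<open>v < u\<close> by simp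
qed

lemma signed_powr_mono:
  fixes u v :: real
  assumes "1 \<le> r" "u \<le> v"
  shows "signed_powr r u \<le> signed_powr r v"
proof (cases "u = v")
  case False
  then show ?thesis
    using order_trans[OF powr_ge_zero signed_powr_diff_ge[of r u v]] assms by simp
qed simp

subsection \<open>Barrier, cutoff and decay\<close>

text \<open>The barrier solves \<open>m \<psi> = t\<^bsup>m+1\<^esup> \<psi>'\<close> on the positive axis and is flat at \<open>0\<close>.\<close>

definition exp_barrier :: "real \<Rightarrow> real \<Rightarrow> real" where
  "exp_barrier m t = (if 0 < t then exp (- (t powr (- m))) else 0)"

definition exp_barrier_deriv :: "real \<Rightarrow> real \<Rightarrow> real" where
  "exp_barrier_deriv m t = (if 0 < t then m * t powr (- m - 1) * exp_barrier m t else 0)"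

lemma exp_barrier_nonneg: "0 \<le> exp_barrier m t"
  by (simp add: exp_barrier_def)

lemma exp_barrier_le_1: "exp_barrier m t \<le> 1"
  by (simp add: exp_barrier_def)

lemma exp_barrier_deriv_nonneg: "0 \<le> m \<Longrightarrow> 0 \<le> exp_barrier_deriv m t"
  by (simp add: exp_barrier_deriv_def exp_barrier_nonneg)

lemma exp_barrier_ode: "0 < t \<Longrightarrow> m * exp_barrier m t = t powr (m + 1) * exp_barrier_deriv m t"
  by (simp add: exp_barrier_deriv_def flip: powr_add)

lemma powr_mult_exp_minus_le:
  fixes a y :: real
  assumes "0 < a" "0 < y"
  shows "y powr a * exp (- y) \<le> a powr a"
proof -
  have "y / a \<le> exp (y / a)"
    using exp_ge_add_one_self[of "y / a"] by linarith
  then have "(y / a) powr a \<le> exp (y / a) powr a"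
    using assms by (intro powr_mono2) auto
  also have "\<dots> = exp y"
    using assms by (simp add: exp_powr_real)
  finally show ?thesis
    using assms by (simp add: powr_divide divide_le_eq exp_minus field_simps)
qed

lemma powr_mult_exp_barrier_le:
  assumes "0 < m" "0 < s" "0 < t"
  shows "t powr (- s) * exp_barrier m t \<le> (s / m) powr (s / m)"
  using powr_mult_exp_minus_le[of "s / m" "t powr (- m)"] assms by (simp add: exp_barrier_def powr_powr)

lemma exp_barrier_deriv_le:
  assumes "0 < m"
  shows "exp_barrier_deriv m t \<le> m * ((m + 1) / m) powr ((m + 1) / m)"
  using powr_mult_exp_barrier_le[of m "m + 1" t] assms
  by (simp add: exp_barrier_deriv_def mult.assoc)

lemma exp_barrier_le_square:
  assumes "0 < m"
  shows "exp_barrier m t \<le> (2 / m) powr (2 / m) * t\<^sup>2"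
proof (cases "0 < t")
  case True
  then show ?thesis
    using powr_mult_exp_barrier_le[of m 2 t] assms by (simp add: powr_minus powr_numeral field_simps)
qed (simp add: exp_barrier_def)

lemma exp_barrier_deriv_le_linear:
  assumes "0 < m"
  shows "exp_barrier_deriv m t \<le> m * ((m + 2) / m) powr ((m + 2) / m) * \<bar>t\<bar>"
proof (cases "0 < t")
  case True
  have "t * t powr (- (m + 2)) = t powr (- m - 1)"
    using True powr_mult_base[of t "- (m + 2)"] by (simp add: algebra_simps minus_diff_commute)
  then have "exp_barrier_deriv m t = m * (t powr (- (m + 2)) * exp_barrier m t) * t"
    using True by (simp add: exp_barrier_deriv_def mult_ac)
  also have "\<dots> \<le> m * ((m + 2) / m) powr ((m + 2) / m) * t"
    using True assms by (intro mult_right_mono mult_left_mono powr_mult_exp_barrier_le) auto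
  finally show ?thesis using True by simp
qed (use assms in \<open>simp add: exp_barrier_deriv_def mult_nonneg_nonpos\<close>)

lemma DERIV_exp_barrier:
  assumes m: "0 < m"
  shows "(exp_barrier m has_real_derivative exp_barrier_deriv m t) (at t)"
proof -
  consider (pos) "0 < t" | (neg) "t < 0" | (zero) "t = 0" by linarith
  then show ?thesis
  proof cases
    case pos
    have "((\<lambda>t. exp (- (t powr (- m)))) has_real_derivative exp_barrier_deriv m t) (at t)"
      using pos by (auto intro!: derivative_eq_intros simp: exp_barrier_deriv_def exp_barrier_def)
    then show ?thesis
      by (rule has_field_derivative_transform_within_open[of _ _ _ "{0<..}"])
        (use pos in \<open>auto simp: exp_barrier_def\<close>)
  next
    case neg
    have "((\<lambda>t. 0) has_real_derivative exp_barrier_deriv m t) (at t)"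
      using neg by (simp add: exp_barrier_deriv_def)
    then show ?thesis
      by (rule has_field_derivative_transform_within_open[of _ _ _ "{..<0}"])
        (use neg in \<open>auto simp: exp_barrier_def\<close>)
  next
    case zero
    define C where "C = (2 / m) powr (2 / m)"
    show ?thesis
      unfolding has_field_derivative_def
    proof (rule has_derivativeI_sandwich[of 1])
      show "norm (exp_barrier m s - exp_barrier m t - exp_barrier_deriv m t * (s - t)) / norm (s - t) \<le> C * \<bar>s\<bar>"
        if "s \<noteq> t" for s
        using zero that exp_barrier_le_square[OF m, of s] exp_barrier_nonneg[of m s]
        by (simp add: exp_barrier_def[of m 0] exp_barrier_deriv_def[of m 0] divide_le_eq power2_eq_square
            abs_mult_self_eq mult.assoc C_def)
      show "((\<lambda>s. C * \<bar>s\<bar>) \<longlongrightarrow> 0) (at t)"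
        using zero by (auto intro!: tendsto_eq_intros)
    qed (auto intro: bounded_linear_mult_right)
  qed
qed

lemma continuous_exp_barrier_deriv:
  assumes m: "0 < m"
  shows "continuous_on UNIV (exp_barrier_deriv m)"
proof -
  have "isCont (exp_barrier_deriv m) t" for t
  proof -
    consider (pos) "t \<in> {0<..}" | (neg) "t \<in> {..<0}" | (zero) "t = 0" by force
    then show ?thesis
    proof cases
      case pos
      have "continuous_on {0<..} (\<lambda>t. m * t powr (- m - 1) * exp (- (t powr (- m))))"
        by (intro continuous_intros) auto
      then have "continuous_on {0<..} (exp_barrier_deriv m)"
        by (rule continuous_on_eq) (simp add: exp_barrier_deriv_def exp_barrier_def)
      with pos show ?thesis
        by (simp add: continuous_on_eq_continuous_at)
    next
      case neg
      have "continuous_on {..<0} (exp_barrier_deriv m)"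
        by (rule continuous_on_eq[OF continuous_on_const[of _ 0]]) (simp add: exp_barrier_deriv_def)
      with neg show ?thesis
        by (simp add: continuous_on_eq_continuous_at)
    next
      case zero
      have "(exp_barrier_deriv m \<longlongrightarrow> 0) (at 0)"
      proof (rule Lim_null_comparison)
        show "\<forall>\<^sub>F t in at 0. norm (exp_barrier_deriv m t) \<le> m * ((m + 2) / m) powr ((m + 2) / m) * \<bar>t\<bar>"
          using exp_barrier_deriv_le_linear[OF m] exp_barrier_deriv_nonneg m by simp
        show "((\<lambda>t. m * ((m + 2) / m) powr ((m + 2) / m) * \<bar>t\<bar>) \<longlongrightarrow> 0) (at 0)"
          by (auto intro!: tendsto_eq_intros)
      qed
      with zero show ?thesis
        by (simp add: isCont_def exp_barrier_deriv_def[of m 0])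
    qed
  qed
  then show ?thesis
    by (simp add: continuous_at_imp_continuous_on)
qed

definition cutoff :: "real \<Rightarrow> real \<Rightarrow> ('a::euclidean_space \<Rightarrow> real) \<Rightarrow> bool" where
  "cutoff B R \<eta> \<longleftrightarrow> \<eta> \<in> C1_0 \<and> (\<forall>x. 0 \<le> \<eta> x \<and> \<eta> x \<le> 1) \<and> (\<forall>x. norm x \<le> R \<longrightarrow> \<eta> x = 1) \<and>
     (\<forall>x. 2 * R \<le> norm x \<longrightarrow> \<eta> x = 0) \<and> (\<forall>x. (norm (grad \<eta> x))\<^sup>2 \<le> B / R\<^sup>2 * \<eta> x)"

text \<open>The square of a bump \<open>\<xi>\<close> works, as \<open>grad (\<xi>\<^sup>2) = 2 \<xi> grad \<xi>\<close>.\<close>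

lemma cutoff_exists:
  obtains B where "0 < B" "\<And>R. 0 < R \<Longrightarrow> \<exists>\<eta>::'a::euclidean_space \<Rightarrow> real. cutoff B R \<eta>"
proof -
  obtain \<xi> :: "'a \<Rightarrow> real" where \<xi>: "\<xi> \<in> C1_0" "\<And>x. 0 \<le> \<xi> x" "\<And>x. \<xi> x \<le> 1"
    "\<And>x. norm x \<le> 1 \<Longrightarrow> \<xi> x = 1" "\<And>x. 2 \<le> norm x \<Longrightarrow> \<xi> x = 0"
    using C1_0_bump_exists by metis
  obtain M where M: "0 < M" "\<And>x. norm (grad \<xi> x) \<le> M"
    using C_c_bound[OF C1_0_grad_C_c[OF \<xi>(1)]] by metis
  have "\<exists>\<eta>::'a \<Rightarrow> real. cutoff (4 * M\<^sup>2) R \<eta>" if R: "0 < R" for R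
  proof
    define \<xi>R where "\<xi>R x = \<xi> (0 + (1 / R) *\<^sub>R x)" for x
    have \<xi>R: "\<xi>R \<in> C1_0" and grad_\<xi>R: "grad \<xi>R x = (1 / R) *\<^sub>R grad \<xi> (0 + (1 / R) *\<^sub>R x)" for x
      using C1_0_affine[OF \<xi>(1), of "1 / R" 0] R unfolding \<xi>R_def[abs_def] by auto
    note square = C1_0_mult[OF C1_0_GDERIV[OF \<xi>R] C_c_continuous[OF C1_0_grad_C_c[OF \<xi>R]] \<xi>R]
    have "(norm (grad (\<lambda>x. \<xi>R x * \<xi>R x) x))\<^sup>2 \<le> 4 * M\<^sup>2 / R\<^sup>2 * (\<xi>R x * \<xi>R x)" for x
    proof -
      have "grad (\<lambda>x. \<xi>R x * \<xi>R x) x = (2 * \<xi>R x / R) *\<^sub>R grad \<xi> (0 + (1 / R) *\<^sub>R x)"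
        unfolding square(2) grad_\<xi>R by (simp flip: scaleR_left_distrib)
      then have "(norm (grad (\<lambda>x. \<xi>R x * \<xi>R x) x))\<^sup>2 = (2 * \<xi>R x / R)\<^sup>2 * (norm (grad \<xi> (0 + (1 / R) *\<^sub>R x)))\<^sup>2"
        by (simp add: power_mult_distrib power_divide)
      also have "\<dots> \<le> (2 * \<xi>R x / R)\<^sup>2 * M\<^sup>2"
        using M by (intro mult_left_mono power_mono) auto
      finally show ?thesis
        by (simp add: power2_eq_square mult_ac)
    qed
    moreover have "\<xi>R x * \<xi>R x \<le> 1" for x
      using mult_le_one[OF \<xi>(3) \<xi>(2,3)] by (simp add: \<xi>R_def)
    ultimately show "cutoff (4 * M\<^sup>2) R (\<lambda>x. \<xi>R x * \<xi>R x)"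
      using square(1) \<xi>(4,5) R by (simp add: cutoff_def \<xi>R_def divide_le_eq le_divide_eq)
  qed
  with M(1) show thesis
    using that[of "4 * M\<^sup>2"] by simp
qed

lemma grad_cutoff_eq_0:
  fixes \<eta> :: "'a::euclidean_space \<Rightarrow> real"
  assumes \<eta>: "cutoff B R \<eta>" and x: "norm x < R \<or> 2 * R \<le> norm x"
  shows "grad \<eta> x = 0"
  using x
proof
  assume "norm x < R"
  then show ?thesis
    using \<eta> by (intro grad_eq_0_of_locally_const[of "ball 0 R" _ _ 1]) (auto simp: cutoff_def)
next
  assume "2 * R \<le> norm x"
  then have "(norm (grad \<eta> x))\<^sup>2 \<le> 0"
    using \<eta> by (metis cutoff_def mult_zero_right)
  then show ?thesis by simp
qed

lemma norm_grad_cutoff_le: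
  fixes \<eta> :: "'a::euclidean_space \<Rightarrow> real"
  assumes \<eta>: "cutoff B R \<eta>" and "0 \<le> B" "1 \<le> R"
  shows "norm (grad \<eta> x) \<le> sqrt B"
proof (rule real_le_rsqrt)
  have "(norm (grad \<eta> x))\<^sup>2 \<le> B / R\<^sup>2 * \<eta> x"
    using \<eta> by (simp add: cutoff_def)
  also have "\<dots> \<le> B / 1 * 1"
    using \<eta> \<open>0 \<le> B\<close> \<open>1 \<le> R\<close> by (intro mult_mono divide_left_mono) (auto simp: cutoff_def)
  finally show "(norm (grad \<eta> x))\<^sup>2 \<le> B" by simp
qed

lemma doubling_decay_growth:
  fixes I :: "real \<Rightarrow> real"
  assumes R0: "0 < R0" and C: "0 \<le> C"
    and decay: "\<And>R. R0 \<le> R \<Longrightarrow> I R \<le> C * R powr (- a) * I (2 * R)"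
    and growth: "\<And>R. R0 \<le> R \<Longrightarrow> I R \<le> C' * R powr b"
  shows "\<exists>D. \<forall>R\<ge>R0. I R \<le> D * R powr (b - real n * a)"
proof (induction n)
  case 0
  then show ?case using growth by auto
next
  case (Suc n)
  then obtain D where D: "\<And>R. R0 \<le> R \<Longrightarrow> I R \<le> D * R powr (b - real n * a)"
    by blast
  have "I R \<le> (C * D * 2 powr (b - real n * a)) * R powr (b - real (Suc n) * a)" if R: "R0 \<le> R" for R
  proof -
    have "I R \<le> C * R powr (- a) * I (2 * R)"
      by (rule decay[OF R])
    also have "\<dots> \<le> C * R powr (- a) * (D * (2 * R) powr (b - real n * a))"
      using R R0 C by (intro mult_left_mono D) auto
    also have "\<dots> = (C * D * 2 powr (b - real n * a)) * (R powr (- a) * R powr (b - real n * a))"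
      using R R0 by (simp add: powr_mult)
    also have "R powr (- a) * R powr (b - real n * a) = R powr (b - real (Suc n) * a)"
      by (simp add: algebra_simps flip: powr_add)
    finally show ?thesis .
  qed
  then show ?case by blast
qed

lemma doubling_decay_imp_zero:
  fixes I :: "real \<Rightarrow> real"
  assumes "0 < R0" "0 \<le> C" and a: "0 < a" and "mono I" and nonneg: "\<And>R. 0 \<le> I R"
    and "\<And>R. R0 \<le> R \<Longrightarrow> I R \<le> C * R powr (- a) * I (2 * R)"
    and "\<And>R. R0 \<le> R \<Longrightarrow> I R \<le> C' * R powr b"
  shows "I R = 0"
proof -
  obtain n :: nat where "b / a < real n"
    using reals_Archimedean2 by blast
  then have n: "b - real n * a < 0"
    using a by (simp add: divide_less_eq)
  obtain D where D: "\<And>S. R0 \<le> S \<Longrightarrow> I S \<le> D * S powr (b - real n * a)"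
    using doubling_decay_growth[OF assms(1,2,6,7), of n] by metis
  have "((\<lambda>S. D * S powr (b - real n * a)) \<longlongrightarrow> 0) at_top"
    using n by (intro tendsto_mult_right_zero tendsto_neg_powr filterlim_ident)
  moreover have "\<forall>\<^sub>F S in at_top. I R \<le> D * S powr (b - real n * a)"
    using eventually_ge_at_top[of "max R R0"]
  proof eventually_elim
    case (elim S)
    then show ?case
      using monoD[OF \<open>mono I\<close>, of R S] D[of S] by simp
  qed
  ultimately have "I R \<le> 0"
    by (intro tendsto_lowerbound[of _ _ at_top]) auto
  with nonneg[of R] show ?thesis by simp
qed

subsection \<open>A maximum principle on the whole space\<close>

lemma le_add_of_square_le_mult:
  fixes y X Y :: real
  assumes "y\<^sup>2 \<le> X * Y" "0 \<le> X" "0 \<le> Y"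
  shows "y \<le> X + Y"
proof (rule power2_le_imp_le)
  have "X * Y \<le> (X + Y)\<^sup>2" using assms by (simp add: power2_sum)
  with assms(1) show "y\<^sup>2 \<le> (X + Y)\<^sup>2" by linarith
qed (use assms in simp)

locale absorbing_inequality =
  fixes p q c A A' \<alpha> \<beta> R0 :: real
    and w G :: "'a::euclidean_space \<Rightarrow> real" and W F :: "'a \<Rightarrow> 'a"
  assumes p: "1 < p" and q: "1 < q"
    and weak_gradient: "has_weak_gradient w W"
    and W_L_loc: "W \<in> L_loc p" and F_L_loc: "F \<in> L_loc (p / (p - 1))" and G_L_loc: "G \<in> L_loc 1"
    and divergence: "weak_divergence_ge F G"
    and absorption: "0 < w x \<Longrightarrow> w x powr q \<le> c * G x"
    and flux_nonneg: "0 \<le> F x \<bullet> W x"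
    and flux_square: "AE x in lebesgue. R0 \<le> norm x \<longrightarrow> (norm (F x))\<^sup>2 \<le> A * norm x powr \<alpha> * (F x \<bullet> W x)"
    and flux_growth: "AE x in lebesgue. R0 \<le> norm x \<longrightarrow> norm (F x) \<le> A' * norm x powr \<beta>"
    and \<alpha>: "0 \<le> \<alpha>" "\<alpha> < 2" and \<beta>: "0 \<le> \<beta>" and constants: "0 < c" "0 < A" "0 < A'" "1 \<le> R0"
begin

abbreviation \<psi> :: "real \<Rightarrow> real" where "\<psi> \<equiv> exp_barrier (q - 1)"

abbreviation \<psi>' :: "real \<Rightarrow> real" where "\<psi>' \<equiv> exp_barrier_deriv (q - 1)"

definition absorbed :: "'a \<Rightarrow> real" where
  "absorbed x = G x * \<psi> (w x)"

definition mass :: "real \<Rightarrow> real" where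
  "mass R = (LINT x:cball 0 R|lebesgue. absorbed x)"

definition dissipation :: "('a \<Rightarrow> real) \<Rightarrow> 'a \<Rightarrow> real" where
  "dissipation \<eta> x = \<eta> x * \<psi>' (w x) * (F x \<bullet> W x)"

definition cutoff_flux :: "('a \<Rightarrow> real) \<Rightarrow> 'a \<Rightarrow> real" where
  "cutoff_flux \<eta> x = \<psi> (w x) * norm (F x) * norm (grad \<eta> x)"

lemma barrier_deriv_nonneg: "0 \<le> \<psi>' t"
  using q by (simp add: exp_barrier_deriv_nonneg)

lemma dissipation_nonneg: "0 \<le> \<eta> x \<Longrightarrow> 0 \<le> dissipation \<eta> x"
  by (simp add: dissipation_def barrier_deriv_nonneg flux_nonneg)

lemma G_pos: "0 < w x \<Longrightarrow> 0 < G x"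
  using absorption[of x] powr_gt_zero[of "w x" q] constants(1)
  by (smt (verit) mult_nonneg_nonpos)

lemma absorbed_nonneg: "0 \<le> absorbed x"
  using G_pos[of x] exp_barrier_nonneg[of "q - 1" "w x"]
  by (cases "0 < w x") (simp_all add: absorbed_def exp_barrier_def)

lemma absorbed_L_loc: "absorbed \<in> L_loc 1"
proof (rule L_loc_dominated[OF L_loc_norm_powr[OF G_L_loc]])
  have "continuous_on UNIV \<psi>"
    using q by (intro continuous_at_imp_continuous_on ballI DERIV_isCont[OF DERIV_exp_barrier]) simp
  then have [measurable]: "\<psi> \<in> borel_measurable borel"
    by (rule borel_measurable_continuous_onI)
  have "w \<in> L_loc 1"
    using weak_gradient by (simp add: has_weak_gradient_def)
  note [measurable] = L_loc_measurable[OF this] L_loc_measurable[OF G_L_loc]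
  show "absorbed \<in> borel_measurable lebesgue"
    unfolding absorbed_def[abs_def] by measurable
  show "norm (absorbed x) powr 1 \<le> norm (G x) powr 1" for x
    using mult_left_mono[OF exp_barrier_le_1[of "q - 1" "w x"] abs_ge_zero[of "G x"]]
      exp_barrier_nonneg[of "q - 1" "w x"]
    by (simp add: absorbed_def abs_mult)
qed

lemma barrier_square_le: "(\<psi> (w x))\<^sup>2 \<le> c / (q - 1) * \<psi>' (w x) * absorbed x"
proof (cases "0 < w x")
  case True
  have "(q - 1) * \<psi> (w x) = w x powr q * \<psi>' (w x)"
    using exp_barrier_ode[OF True, of "q - 1"] by simp
  also have "\<dots> \<le> c * G x * \<psi>' (w x)"
    by (intro mult_right_mono absorption[OF True] barrier_deriv_nonneg)
  finally have "\<psi> (w x) \<le> c * G x * \<psi>' (w x) / (q - 1)"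
    using q by (simp add: le_divide_eq mult.commute)
  from mult_right_mono[OF this exp_barrier_nonneg] show ?thesis
    by (simp add: absorbed_def power2_eq_square mult_ac)
qed (simp add: exp_barrier_def exp_barrier_deriv_def)

lemma absorbed_integrable: "integrable lebesgue (\<lambda>x. indicat_real (cball 0 R) x *\<^sub>R absorbed x)"
  by (rule L_loc_1_integrable_cball[OF absorbed_L_loc])

lemma mass_nonneg: "0 \<le> mass R"
  unfolding mass_def set_lebesgue_integral_def
  using absorbed_nonneg by (intro Bochner_Integration.integral_nonneg) auto

lemma mono_mass: "mono mass"
proof (rule monoI)
  fix R S :: real assume "R \<le> S"
  then have "indicat_real (cball 0 R) x *\<^sub>R absorbed x \<le> indicat_real (cball 0 S) x *\<^sub>R absorbed x" for x
    using absorbed_nonneg[of x] by (auto simp: indicator_def)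
  then show "mass R \<le> mass S"
    unfolding mass_def set_lebesgue_integral_def by (intro integral_mono absorbed_integrable)
qed

lemma mass_le:
  assumes \<eta>: "cutoff B R \<eta>" and K: "K \<in> L_loc 1"
    and bound: "AE x in lebesgue. cutoff_flux \<eta> x \<le> dissipation \<eta> x + indicat_real (cball 0 (2 * R)) x *\<^sub>R K x"
  shows "mass R \<le> (LINT x:cball 0 (2 * R)|lebesgue. K x)"
proof -
  interpret test: composition_test p "(q - 1) * (q / (q - 1)) powr (q / (q - 1))" w W F G \<eta> \<psi> \<psi>'
  proof
    show "\<bar>\<psi>' t\<bar> \<le> (q - 1) * (q / (q - 1)) powr (q / (q - 1))" for t
      using exp_barrier_deriv_le[of "q - 1" t] barrier_deriv_nonneg[of t] q by simp
  qed (use \<eta> q in \<open>auto simp: cutoff_def p weak_gradient W_L_loc F_L_loc G_L_loc divergence exp_barrier_nonneg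
      exp_barrier_le_1 intro: DERIV_exp_barrier continuous_exp_barrier_deriv\<close>)
  let ?test = "\<lambda>x. test.integrand (w x) (W x) x" and ?K = "\<lambda>x. indicat_real (cball 0 (2 * R)) x *\<^sub>R K x"
  have K_int: "integrable lebesgue ?K"
    by (rule L_loc_1_integrable_cball[OF K])
  have "mass R \<le> (LINT x|lebesgue. ?test x + ?K x)"
    unfolding mass_def set_lebesgue_integral_def
  proof (rule integral_mono_AE[OF absorbed_integrable])
    show "integrable lebesgue (\<lambda>x. ?test x + ?K x)"
      by (intro Bochner_Integration.integrable_add test.integrable_integrand K_int)
    show "AE x in lebesgue. indicat_real (cball 0 R) x *\<^sub>R absorbed x \<le> ?test x + ?K x"
      using bound
    proof eventually_elim
      case (elim x)
      have "- (F x \<bullet> grad \<eta> x) \<le> norm (F x) * norm (grad \<eta> x)"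
        using Cauchy_Schwarz_ineq2[of "F x" "grad \<eta> x"] by linarith
      from mult_left_mono[OF this exp_barrier_nonneg]
      have "- (\<psi> (w x) * (F x \<bullet> grad \<eta> x)) \<le> cutoff_flux \<eta> x"
        by (simp add: cutoff_flux_def mult.assoc)
      with elim have "absorbed x * \<eta> x \<le> ?test x + ?K x"
        by (simp add: test.integrand_def absorbed_def dissipation_def inner_add_right mult_ac)
      moreover have "indicat_real (cball 0 R) x *\<^sub>R absorbed x \<le> absorbed x * \<eta> x"
        using \<eta> absorbed_nonneg[of x] by (auto simp: cutoff_def indicator_def)
      ultimately show ?case by linarith
    qed
  qed
  also have "\<dots> = (LINT x|lebesgue. ?test x) + (LINT x:cball 0 (2 * R)|lebesgue. K x)"
    using test.integrable_integrand K_int by (simp add: set_lebesgue_integral_def)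
  finally show ?thesis
    using test.integral_integrand_le by linarith
qed

lemma mass_le_of_annulus:
  assumes \<eta>: "cutoff B R \<eta>" and R: "R0 \<le> R" and K: "K \<in> L_loc 1" "\<And>x. 0 \<le> K x"
    and bound: "\<And>x. norm x \<le> 2 * R \<Longrightarrow> (norm (F x))\<^sup>2 \<le> A * norm x powr \<alpha> * (F x \<bullet> W x) \<Longrightarrow>
      norm (F x) \<le> A' * norm x powr \<beta> \<Longrightarrow> cutoff_flux \<eta> x \<le> dissipation \<eta> x + K x"
  shows "mass R \<le> (LINT x:cball 0 (2 * R)|lebesgue. K x)"
proof (rule mass_le[OF \<eta> K(1)])
  show "AE x in lebesgue. cutoff_flux \<eta> x \<le> dissipation \<eta> x + indicat_real (cball 0 (2 * R)) x *\<^sub>R K x"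
    using flux_square flux_growth
  proof eventually_elim
    case (elim x)
    show ?case
    proof (cases "R \<le> norm x \<and> norm x < 2 * R")
      case True
      then show ?thesis
        using bound[of x] elim R by simp
    next
      case False
      then have "cutoff_flux \<eta> x = 0"
        using grad_cutoff_eq_0[OF \<eta>, of x] by (auto simp: cutoff_flux_def)
      moreover have "0 \<le> dissipation \<eta> x"
        using \<eta> by (intro dissipation_nonneg) (simp add: cutoff_def)
      ultimately show ?thesis
        using K(2)[of x] by simp
    qed
  qed
qed

lemma cutoff_flux_le:
  assumes \<eta>: "cutoff B R \<eta>" and B: "0 \<le> B"
    and x: "norm x \<le> 2 * R" and square: "(norm (F x))\<^sup>2 \<le> A * norm x powr \<alpha> * (F x \<bullet> W x)"
  shows "cutoff_flux \<eta> x \<le> dissipation \<eta> x + c / (q - 1) * (A * (2 * R) powr \<alpha>) * (B / R\<^sup>2) * absorbed x"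
    (is "_ \<le> _ + ?D * absorbed x")
proof (rule le_add_of_square_le_mult)
  have "A * norm x powr \<alpha> * (F x \<bullet> W x) \<le> A * (2 * R) powr \<alpha> * (F x \<bullet> W x)"
    using x \<alpha> constants flux_nonneg by (intro mult_right_mono mult_left_mono powr_mono2) auto
  with square have F_le: "(norm (F x))\<^sup>2 \<le> A * (2 * R) powr \<alpha> * (F x \<bullet> W x)"
    by linarith
  have grad_le: "(norm (grad \<eta> x))\<^sup>2 \<le> B / R\<^sup>2 * \<eta> x" and \<eta>_nonneg: "0 \<le> \<eta> x"
    using \<eta> by (auto simp: cutoff_def)
  have "(cutoff_flux \<eta> x)\<^sup>2 = (\<psi> (w x))\<^sup>2 * (norm (F x))\<^sup>2 * (norm (grad \<eta> x))\<^sup>2"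
    by (simp add: cutoff_flux_def power_mult_distrib)
  also have "\<dots> \<le> (c / (q - 1) * \<psi>' (w x) * absorbed x) * (A * (2 * R) powr \<alpha> * (F x \<bullet> W x)) * (B / R\<^sup>2 * \<eta> x)"
    using barrier_square_le[of x] F_le grad_le barrier_deriv_nonneg absorbed_nonneg[of x] flux_nonneg[of x]
      constants q
    by (intro mult_mono) auto
  also have "\<dots> = dissipation \<eta> x * (?D * absorbed x)"
    unfolding dissipation_def by (simp only: mult_ac)
  finally show "(cutoff_flux \<eta> x)\<^sup>2 \<le> dissipation \<eta> x * (?D * absorbed x)" .
  show "0 \<le> dissipation \<eta> x"
    using \<eta>_nonneg by (rule dissipation_nonneg)
  show "0 \<le> ?D * absorbed x"
    using constants q B absorbed_nonneg[of x] by simp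
qed

lemma mass_decay:
  obtains C where "0 \<le> C" "\<And>R. R0 \<le> R \<Longrightarrow> mass R \<le> C * R powr (- (2 - \<alpha>)) * mass (2 * R)"
proof -
  obtain B where B: "0 < B" "\<And>R. 0 < R \<Longrightarrow> \<exists>\<eta>::'a \<Rightarrow> real. cutoff B R \<eta>"
    using cutoff_exists by metis
  define C where "C = c / (q - 1) * A * 2 powr \<alpha> * B"
  have C: "0 \<le> C"
    using constants B(1) q by (simp add: C_def)
  have "mass R \<le> C * R powr (- (2 - \<alpha>)) * mass (2 * R)" if R: "R0 \<le> R" for R
  proof -
    have "0 < R" using R constants by simp
    then obtain \<eta> :: "'a \<Rightarrow> real" where \<eta>: "cutoff B R \<eta>"
      using B(2) by blast
    define D where "D = c / (q - 1) * (A * (2 * R) powr \<alpha>) * (B / R\<^sup>2)"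
    have D: "D = C * R powr (- (2 - \<alpha>))"
      using \<open>0 < R\<close> by (simp add: D_def C_def powr_mult powr_diff powr_numeral)
    have "mass R \<le> (LINT x:cball 0 (2 * R)|lebesgue. D * absorbed x)"
    proof (rule mass_le_of_annulus[OF \<eta> R])
      show "(\<lambda>x. D * absorbed x) \<in> L_loc 1"
        using L_loc_1_scaleR[OF absorbed_L_loc, of D] by simp
      show "0 \<le> D * absorbed x" for x
        using C absorbed_nonneg by (simp add: D)
    qed (use cutoff_flux_le[OF \<eta>] B(1) in \<open>simp add: D_def\<close>)
    then show ?thesis
      by (simp add: mass_def D)
  qed
  with C show thesis by (rule that)
qed

lemma mass_growth:
  obtains C b where "\<And>R. R0 \<le> R \<Longrightarrow> mass R \<le> C * R powr b"
proof -
  obtain B where B: "0 < B" "\<And>R. 0 < R \<Longrightarrow> \<exists>\<eta>::'a \<Rightarrow> real. cutoff B R \<eta>"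
    using cutoff_exists by metis
  define N where "N = real DIM('a)"
  define C where "C = A' * 2 powr \<beta> * sqrt B * (unit_ball_vol N * 2 powr N)"
  have "mass R \<le> C * R powr (\<beta> + N)" if R: "R0 \<le> R" for R
  proof -
    have "1 \<le> R" using R constants by simp
    then obtain \<eta> :: "'a \<Rightarrow> real" where \<eta>: "cutoff B R \<eta>"
      using B(2)[of R] by force
    have "mass R \<le> (LINT x:cball (0::'a) (2 * R)|lebesgue. A' * (2 * R) powr \<beta> * sqrt B)"
    proof (rule mass_le_of_annulus[OF \<eta> R])
      show "(\<lambda>_::'a. A' * (2 * R) powr \<beta> * sqrt B) \<in> L_loc 1"
        by (rule L_loc_const)
      show "0 \<le> A' * (2 * R) powr \<beta> * sqrt B"
        using constants B(1) by simp
      fix x assume x: "norm x \<le> 2 * R" and growth: "norm (F x) \<le> A' * norm x powr \<beta>"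
      have "A' * norm x powr \<beta> \<le> A' * (2 * R) powr \<beta>"
        using x \<beta> constants by (intro mult_left_mono powr_mono2) auto
      with growth have "norm (F x) \<le> A' * (2 * R) powr \<beta>"
        by linarith
      then have "cutoff_flux \<eta> x \<le> 1 * (A' * (2 * R) powr \<beta>) * sqrt B"
        unfolding cutoff_flux_def using norm_grad_cutoff_le[OF \<eta>] B(1) \<open>1 \<le> R\<close> constants
        by (intro mult_mono exp_barrier_le_1) (auto simp: exp_barrier_nonneg)
      moreover have "0 \<le> dissipation \<eta> x"
        using \<eta> by (intro dissipation_nonneg) (simp add: cutoff_def)
      ultimately show "cutoff_flux \<eta> x \<le> dissipation \<eta> x + A' * (2 * R) powr \<beta> * sqrt B"
        by simp
    qed
    also have "\<dots> = A' * (2 * R) powr \<beta> * sqrt B * measure lebesgue (cball (0::'a) (2 * R))"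
      by (simp add: set_lebesgue_integral_def)
    also have "measure lebesgue (cball (0::'a) (2 * R)) = unit_ball_vol N * (2 * R) powr N"
      using \<open>1 \<le> R\<close> content_cball[of "2 * R" "0::'a"] by (simp add: N_def powr_realpow)
    finally show ?thesis
      using \<open>1 \<le> R\<close> by (simp add: C_def powr_mult powr_add mult_ac)
  qed
  then show thesis by (rule that)
qed

theorem nonpositive: "AE x in lebesgue. w x \<le> 0"
proof -
  obtain C where C: "0 \<le> C" "\<And>R. R0 \<le> R \<Longrightarrow> mass R \<le> C * R powr (- (2 - \<alpha>)) * mass (2 * R)"
    using mass_decay by metis
  obtain C' b where growth: "\<And>R. R0 \<le> R \<Longrightarrow> mass R \<le> C' * R powr b"
    using mass_growth by metis
  have "mass R = 0" for R
    using \<alpha>(2) constants(4)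
    by (intro doubling_decay_imp_zero[OF _ C(1) _ mono_mass mass_nonneg C(2) growth]) auto
  then have "AE x in lebesgue. indicat_real (cball 0 (real n)) x *\<^sub>R absorbed x = 0" for n
    using absorbed_nonneg absorbed_integrable[of "real n"]
    by (subst integral_nonneg_eq_0_iff_AE[symmetric]) (auto simp: mass_def set_lebesgue_integral_def)
  then have "AE x in lebesgue. \<forall>n. indicat_real (cball 0 (real n)) x *\<^sub>R absorbed x = 0"
    by (subst AE_all_countable) simp
  then show ?thesis
  proof eventually_elim
    case (elim x)
    obtain n :: nat where "norm x \<le> real n"
      using real_arch_simple by blast
    then have "absorbed x = 0"
      using elim[rule_format, of n] by simp
    then show ?case
      using G_pos[of x] by (auto simp: absorbed_def exp_barrier_def split: if_splits)
  qed
qed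

end

subsection \<open>Comparison and the bounds on solutions\<close>

definition weak_form ::
    "real \<Rightarrow> real \<Rightarrow> ('a::euclidean_space \<Rightarrow> real) \<Rightarrow> ('a \<Rightarrow> 'a) \<Rightarrow> ('a \<Rightarrow> real) \<Rightarrow> real" where
  "weak_form p q u U \<phi> = (LINT x|lebesgue. signed_powr (p - 1) (U x) \<bullet> grad \<phi> x)
     + (LINT x|lebesgue. signed_powr q (u x) * \<phi> x)"

definition subcritical_growth :: "real \<Rightarrow> ('a::euclidean_space \<Rightarrow> 'a) \<Rightarrow> bool" where
  "subcritical_growth p U \<longleftrightarrow> (\<exists>\<theta> c R. \<theta> < 1 / (p - 2) \<and> c > 0 \<and>
     (AE x in lebesgue. norm x \<ge> R \<longrightarrow> norm (U x) \<le> c * norm x powr \<theta>))"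

definition admissible :: "real \<Rightarrow> real \<Rightarrow> ('a::euclidean_space \<Rightarrow> real) \<Rightarrow> ('a \<Rightarrow> 'a) \<Rightarrow> bool" where
  "admissible p q u U \<longleftrightarrow> has_weak_gradient u U \<and> U \<in> L_loc p \<and> u \<in> L_loc q \<and> subcritical_growth p U"

lemma class_K_admissible: "u \<in> class_K p q \<Longrightarrow> admissible p q u (weak_grad u)"
  unfolding class_K_def W1_loc_def admissible_def subcritical_growth_def weak_grad_def
  by (auto intro: someI[of "has_weak_gradient u"])

lemma admissible_const:
  assumes "2 < p"
  shows "admissible p q (\<lambda>_. k) (\<lambda>_. 0)"
proof -
  have "subcritical_growth p (\<lambda>_. 0)"
    unfolding subcritical_growth_def using assms by (intro exI[of _ 0] exI[of _ 1]) simp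
  then show ?thesis
    by (simp add: admissible_def has_weak_gradient_const L_loc_const)
qed

lemma weak_solution_weak_form:
  assumes "weak_solution p q h u" "\<phi> \<in> C1_0"
  shows "weak_form p q u (weak_grad u) \<phi> = (LINT x|lebesgue. h x * \<phi> x)"
  using assms by (simp add: weak_solution_def weak_form_def signed_powr_def)

lemma weak_form_const: "weak_form p q (\<lambda>_. k) (\<lambda>_. 0) \<phi> = (LINT x|lebesgue. signed_powr q k * \<phi> x)"
  by (simp add: weak_form_def signed_powr_def)

lemma weak_divergence_ge_diff:
  fixes u v :: "'a::euclidean_space \<Rightarrow> real"
  assumes "1 < p" and U: "U \<in> L_loc p" and V: "V \<in> L_loc p" and u: "u \<in> L_loc q" and v: "v \<in> L_loc q"
    and forms_le: "\<And>\<phi>. \<phi> \<in> C1_0 \<Longrightarrow> (\<And>x. 0 \<le> \<phi> x) \<Longrightarrow> weak_form p q u U \<phi> \<le> weak_form p q v V \<phi>"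
  shows "weak_divergence_ge (\<lambda>x. signed_powr (p - 1) (U x) - signed_powr (p - 1) (V x))
    (\<lambda>x. signed_powr q (u x) - signed_powr q (v x))"
  unfolding weak_divergence_ge_def
proof (intro ballI impI)
  fix \<phi> :: "'a \<Rightarrow> real" assume \<phi>: "\<phi> \<in> C1_0" "\<forall>x. 0 \<le> \<phi> x"
  have flux: "integrable lebesgue (\<lambda>x. signed_powr (p - 1) (W x) \<bullet> grad \<phi> x)"
    if "W \<in> L_loc p" for W :: "'a \<Rightarrow> 'a"
  proof -
    have "(\<lambda>x. signed_powr (p - 1) (W x)) \<in> L_loc 1"
      using \<open>1 < p\<close> by (intro L_loc_mono[OF L_loc_signed_powr_conjugate[OF _ that]]) auto
    then show ?thesis
      by (intro integrable_inner_L_loc_1_C_c C1_0_grad_C_c \<phi>(1))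
  qed
  have power: "integrable lebesgue (\<lambda>x. signed_powr q (w x) * \<phi> x)" if "w \<in> L_loc q" for w :: "'a \<Rightarrow> real"
    using that by (intro integrable_mult_L_loc_1_C_c C1_0_C_c[OF \<phi>(1)] L_loc_signed_powr) simp
  have "(LINT x|lebesgue. (signed_powr (p - 1) (U x) - signed_powr (p - 1) (V x)) \<bullet> grad \<phi> x
        + (signed_powr q (u x) - signed_powr q (v x)) * \<phi> x) = weak_form p q u U \<phi> - weak_form p q v V \<phi>"
    using flux[OF U] flux[OF V] power[OF u] power[OF v]
    by (simp add: weak_form_def inner_diff_left left_diff_distrib)
  also have "\<dots> \<le> 0"
    using forms_le \<phi> by simp
  finally show "(LINT x|lebesgue. (signed_powr (p - 1) (U x) - signed_powr (p - 1) (V x)) \<bullet> grad \<phi> x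
      + (signed_powr q (u x) - signed_powr q (v x)) * \<phi> x) \<le> 0" .
qed

lemma subcritical_growth_common:
  assumes p: "2 < p" and "subcritical_growth p U" "subcritical_growth p V"
  obtains \<theta> c R where "0 \<le> \<theta>" "\<theta> * (p - 2) < 1" "0 < c" "1 \<le> R"
    "AE x in lebesgue. R \<le> norm x \<longrightarrow> max (norm (U x)) (norm (V x)) \<le> c * norm x powr \<theta>"
proof -
  obtain \<theta>1 c1 R1 where U: "\<theta>1 < 1 / (p - 2)" "0 < c1"
    "AE x in lebesgue. R1 \<le> norm x \<longrightarrow> norm (U x) \<le> c1 * norm x powr \<theta>1"
    using assms(2) by (auto simp: subcritical_growth_def)
  obtain \<theta>2 c2 R2 where V: "\<theta>2 < 1 / (p - 2)" "0 < c2"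
    "AE x in lebesgue. R2 \<le> norm x \<longrightarrow> norm (V x) \<le> c2 * norm x powr \<theta>2"
    using assms(3) by (auto simp: subcritical_growth_def)
  define \<theta> c R where "\<theta> = max 0 (max \<theta>1 \<theta>2)" and "c = max c1 c2" and "R = max 1 (max R1 R2)"
  have "\<theta> < 1 / (p - 2)"
    using U(1) V(1) p by (simp add: \<theta>_def)
  then have "\<theta> * (p - 2) < 1"
    using p by (simp add: pos_less_divide_eq)
  moreover have "AE x in lebesgue. R \<le> norm x \<longrightarrow> max (norm (U x)) (norm (V x)) \<le> c * norm x powr \<theta>"
    using U(3) V(3)
  proof eventually_elim
    case (elim x)
    show ?case
    proof
      assume x: "R \<le> norm x"
      then have "c1 * norm x powr \<theta>1 \<le> c * norm x powr \<theta>" "c2 * norm x powr \<theta>2 \<le> c * norm x powr \<theta>"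
        using U(2) V(2) by (auto simp: c_def \<theta>_def R_def intro!: mult_mono powr_mono)
      with elim x show "max (norm (U x)) (norm (V x)) \<le> c * norm x powr \<theta>"
        by (auto simp: R_def)
    qed
  qed
  ultimately show thesis
    using U(2) by (intro that[of \<theta> c R]) (auto simp: \<theta>_def c_def R_def)
qed

theorem comparison_principle:
  fixes u v :: "'a::euclidean_space \<Rightarrow> real"
  assumes p: "2 < p" and q: "1 < q" and u: "admissible p q u U" and v: "admissible p q v V"
    and forms_le: "\<And>\<phi>. \<phi> \<in> C1_0 \<Longrightarrow> (\<And>x. 0 \<le> \<phi> x) \<Longrightarrow> weak_form p q u U \<phi> \<le> weak_form p q v V \<phi>"
  shows "AE x in lebesgue. u x \<le> v x"
proof -
  define w W where "w x = u x - v x" and "W x = U x - V x" for x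
  define F G where "F x = signed_powr (p - 1) (U x) - signed_powr (p - 1) (V x)"
    and "G x = signed_powr q (u x) - signed_powr q (v x)" for x
  note props = u[unfolded admissible_def] v[unfolded admissible_def]
  obtain \<theta> c R where \<theta>: "0 \<le> \<theta>" "\<theta> * (p - 2) < 1" and constants: "0 < c" "1 \<le> R"
    and growth: "AE x in lebesgue. R \<le> norm x \<longrightarrow> max (norm (U x)) (norm (V x)) \<le> c * norm x powr \<theta>"
    by (rule subcritical_growth_common[OF p, of U V]) (use props in auto)
  have powr_growth: "(c * norm x powr \<theta>) powr s = c powr s * norm x powr (\<theta> * s)" for x s
    using constants by (simp add: powr_mult powr_powr)
  have flux_square: "(norm (F x))\<^sup>2 \<le> 2 * p\<^sup>2 * c powr (p - 2) * norm x powr (\<theta> * (p - 2)) * (F x \<bullet> W x)"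
    if "max (norm (U x)) (norm (V x)) \<le> c * norm x powr \<theta>" for x
    using norm_signed_powr_diff_square_le[of "p - 1" "U x" "c * norm x powr \<theta>" "V x"] that p
    by (simp add: F_def W_def powr_growth mult.assoc)
  have flux_growth: "norm (F x) \<le> 2 * c powr (p - 1) * norm x powr (\<theta> * (p - 1))"
    if "max (norm (U x)) (norm (V x)) \<le> c * norm x powr \<theta>" for x
    using norm_signed_powr_diff_le_twice[of "p - 1" "U x" "c * norm x powr \<theta>" "V x"] that p
    by (simp add: F_def powr_growth)
  interpret absorbing_inequality p q "2 powr q" "2 * p\<^sup>2 * c powr (p - 2)" "2 * c powr (p - 1)"
    "\<theta> * (p - 2)" "\<theta> * (p - 1)" R w G W F
  proof
    show "has_weak_gradient w W"
      using props by (simp add: w_def[abs_def] W_def[abs_def] has_weak_gradient_diff)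
    show "W \<in> L_loc p" "F \<in> L_loc (p / (p - 1))" "G \<in> L_loc 1"
      unfolding W_def[abs_def] F_def[abs_def] G_def[abs_def]
      using props p by (auto intro!: L_loc_diff L_loc_signed_powr_conjugate L_loc_signed_powr)
    show "weak_divergence_ge F G"
      unfolding F_def[abs_def] G_def[abs_def] using props p forms_le by (intro weak_divergence_ge_diff) auto
    show "w x powr q \<le> 2 powr q * G x" if "0 < w x" for x
      using signed_powr_diff_ge[of q "v x" "u x"] that q
      by (simp add: w_def G_def powr_divide divide_le_eq mult.commute)
    show "0 \<le> F x \<bullet> W x" for x
      using order_trans[OF _ signed_powr_diff_inner_ge[of "p - 1" "U x" "V x"]] p by (simp add: F_def W_def)
    show "AE x in lebesgue. R \<le> norm x \<longrightarrow>
        (norm (F x))\<^sup>2 \<le> 2 * p\<^sup>2 * c powr (p - 2) * norm x powr (\<theta> * (p - 2)) * (F x \<bullet> W x)"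
      using growth by eventually_elim (use flux_square in blast)
    show "AE x in lebesgue. R \<le> norm x \<longrightarrow> norm (F x) \<le> 2 * c powr (p - 1) * norm x powr (\<theta> * (p - 1))"
      using growth by eventually_elim (use flux_growth in blast)
  qed (use p q \<theta> constants in auto)
  show ?thesis
    using nonpositive by eventually_elim (simp add: w_def)
qed

lemma integral_mult_test_mono:
  fixes f g \<phi> :: "'a::euclidean_space \<Rightarrow> real"
  assumes f: "f \<in> L_loc 1" and g: "g \<in> L_loc 1" and data_le: "AE x in lebesgue. f x \<le> g x"
    and \<phi>: "\<phi> \<in> C1_0" "\<And>x. 0 \<le> \<phi> x"
  shows "(LINT x|lebesgue. f x * \<phi> x) \<le> (LINT x|lebesgue. g x * \<phi> x)"
proof (rule integral_mono_AE)
  show "AE x in lebesgue. f x * \<phi> x \<le> g x * \<phi> x"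
    using data_le by eventually_elim (intro mult_right_mono \<phi>(2))
qed (intro integrable_mult_L_loc_1_C_c f g C1_0_C_c \<phi>)+

lemma comparison_of_data:
  fixes u v f g :: "'a::euclidean_space \<Rightarrow> real"
  assumes "2 < p" "1 < q" "admissible p q u U" "admissible p q v V"
    and f: "f \<in> L_loc 1" and g: "g \<in> L_loc 1" and data_le: "AE x in lebesgue. f x \<le> g x"
    and u: "\<And>\<phi>. \<phi> \<in> C1_0 \<Longrightarrow> weak_form p q u U \<phi> = (LINT x|lebesgue. f x * \<phi> x)"
    and v: "\<And>\<phi>. \<phi> \<in> C1_0 \<Longrightarrow> weak_form p q v V \<phi> = (LINT x|lebesgue. g x * \<phi> x)"
  shows "AE x in lebesgue. u x \<le> v x"
  by (rule comparison_principle[OF assms(1-4)]) (simp add: u v integral_mult_test_mono[OF f g data_le])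

lemma weak_solutions_le:
  assumes "2 < p" "1 < q" and h: "h \<in> L_loc 1" and u: "u \<in> class_K p q" "weak_solution p q h u"
    and v: "v \<in> class_K p q" "weak_solution p q h v"
  shows "AE x in lebesgue. u x \<le> v x"
  by (rule comparison_of_data[OF assms(1,2) class_K_admissible[OF u(1)] class_K_admissible[OF v(1)] h h _
        weak_solution_weak_form[OF u(2)] weak_solution_weak_form[OF v(2)]]) simp

lemma weak_solution_le:
  assumes p: "2 < p" and q: "1 < q" and h: "h \<in> L_loc 1"
    and v: "v \<in> class_K p q" "weak_solution p q h v" and H: "AE x in lebesgue. h x \<le> H"
  shows "AE x in lebesgue. signed_powr q (v x) \<le> H"
proof -
  obtain k where k: "signed_powr q k = H"
    using signed_powr_surj[of q H] q by auto
  have "AE x in lebesgue. v x \<le> k"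
    by (rule comparison_of_data[OF p q class_K_admissible[OF v(1)] admissible_const[OF p] h L_loc_const
          H[folded k] weak_solution_weak_form[OF v(2)] weak_form_const])
  then show ?thesis
    unfolding k[symmetric] by eventually_elim (use q in \<open>simp add: signed_powr_mono\<close>)
qed

lemma weak_solution_ge:
  assumes p: "2 < p" and q: "1 < q" and h: "h \<in> L_loc 1"
    and v: "v \<in> class_K p q" "weak_solution p q h v" and H: "AE x in lebesgue. H \<le> h x"
  shows "AE x in lebesgue. H \<le> signed_powr q (v x)"
proof -
  obtain k where k: "signed_powr q k = H"
    using signed_powr_surj[of q H] q by auto
  have "AE x in lebesgue. k \<le> v x"
    by (rule comparison_of_data[OF p q admissible_const[OF p] class_K_admissible[OF v(1)] L_loc_const h
          H[folded k] weak_form_const weak_solution_weak_form[OF v(2)]])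
  then show ?thesis
    unfolding k[symmetric] by eventually_elim (use q in \<open>simp add: signed_powr_mono\<close>)
qed

lemma essinf_AE: "AE x in M. essinf M f \<le> f x"
proof -
  let ?A = "{z. AE x in M. z \<le> f x}"
  have "- \<infinity> \<in> ?A" by simp
  then obtain z :: "nat \<Rightarrow> ereal" where z: "range z \<subseteq> ?A" "Sup ?A = (SUP i. z i)"
    using Sup_countable_SUP[of ?A] by blast
  then have "AE x in M. \<forall>i. z i \<le> f x"
    by (subst AE_all_countable) auto
  then show ?thesis
    unfolding essinf_def z(2) by eventually_elim (auto intro: SUP_least)
qed

lemma AE_le_esssupI:
  fixes f h :: "'a \<Rightarrow> real"
  assumes "\<And>H. AE x in M. h x \<le> H \<Longrightarrow> AE x in M. f x \<le> H"
  shows "AE x in M. ereal (f x) \<le> esssup M (\<lambda>x. ereal (h x))"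
proof (cases "esssup M (\<lambda>x. ereal (h x))")
  case (real H)
  then show ?thesis
    using assms[of H] esssup_AE[of "\<lambda>x. ereal (h x)" M] by simp
next
  case MInf
  then show ?thesis
    using esssup_AE[of "\<lambda>x. ereal (h x)" M] by simp
qed simp

lemma AE_essinf_leI:
  fixes f h :: "'a \<Rightarrow> real"
  assumes "\<And>H. AE x in M. H \<le> h x \<Longrightarrow> AE x in M. H \<le> f x"
  shows "AE x in M. essinf M (\<lambda>x. ereal (h x)) \<le> ereal (f x)"
proof (cases "essinf M (\<lambda>x. ereal (h x))")
  case (real H)
  then show ?thesis
    using assms[of H] essinf_AE[of M "\<lambda>x. ereal (h x)"] by simp
next
  case PInf
  then show ?thesis
    using essinf_AE[of M "\<lambda>x. ereal (h x)"] by simp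
qed simp

theorem theorem1p4:
  fixes p q :: real and h :: "real ^ 'n \<Rightarrow> real"
  assumes "p > 2" and "q > p - 1" and "h \<in> L_loc 1"
  shows "(\<forall>u v. u \<in> class_K p q \<and> weak_solution p q h u \<and> v \<in> class_K p q \<and> weak_solution p q h v
            \<longrightarrow> (AE x in lebesgue. u x = v x)) \<and>
         (\<forall>v. v \<in> class_K p q \<and> weak_solution p q h v
            \<longrightarrow> (AE x in lebesgue.
                  essinf lebesgue (\<lambda>x. ereal (h x)) \<le> ereal (\<bar>v x\<bar> powr (q - 1) * v x) \<and>
                  ereal (\<bar>v x\<bar> powr (q - 1) * v x) \<le> esssup lebesgue (\<lambda>x. ereal (h x))))"
proof (intro conjI allI impI)
  have q: "1 < q" using assms(1,2) by simp
  show "AE x in lebesgue. u x = v x"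
    if "u \<in> class_K p q \<and> weak_solution p q h u \<and> v \<in> class_K p q \<and> weak_solution p q h v" for u v
  proof -
    have "AE x in lebesgue. u x \<le> v x" "AE x in lebesgue. v x \<le> u x"
      using weak_solutions_le[OF assms(1) q assms(3)] that by blast+
    then show ?thesis by eventually_elim simp
  qed
  show "AE x in lebesgue. essinf lebesgue (\<lambda>x. ereal (h x)) \<le> ereal (\<bar>v x\<bar> powr (q - 1) * v x) \<and>
      ereal (\<bar>v x\<bar> powr (q - 1) * v x) \<le> esssup lebesgue (\<lambda>x. ereal (h x))"
    if "v \<in> class_K p q \<and> weak_solution p q h v" for v
    unfolding signed_powr_real[symmetric]
    using that weak_solution_le[OF assms(1) q assms(3)] weak_solution_ge[OF assms(1) q assms(3)]
    by (intro AE_conjI AE_le_esssupI AE_essinf_leI) blast+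
qed

end
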